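(* Let $L:A\to\mathbb R$ be a linear positive semidefinite functional and let $Q\subseteq A$. Then there exists a unique representing measure $\nu_L$ for $L$ with compact support which is a subset of the closed set $\{\alpha\in X(A):\alpha(q)\ge 0 \text{ for all } q\in Q\}$ if and only if $C_a=\sup_{n\in\mathbb N}\sqrt[2n]{L(a^{2n})}<\infty$ for all $a\in A$ and $Q\subseteq Q_L$. Moreover, in this case, the support of $\nu_L$ is a subset of the set $$\{\alpha\in X(A):|\alpha(a)|\le C_a\text{ for all }a\in A,\ \alpha(q)\ge 0 \text{ for all } q\in Q\}.$$
   Context: $A$ is a unital commutative $\mathbb R$-algebra and $X(A)$ is the set of all (unital) $\mathbb R$-algebra homomorphisms $A\to\mathbb R$, assumed non-empty and endowed with the topology of pointwise convergence. $\mathbb N=\{1,2,\dots\}$. A linear functional $L:A\to\mathbb R$ is positive semidefinite if $L(a^2)\ge 0$ for all $a\in A$. A representing measure for $L$ is a positive Radon measure $\mu$ on $X(A)$ such that $L(a)=\int\alpha(a)\,d\mu(\alpha)$ for all $a\in A$. For a linear functional $L$, $Q_L:=\{a\in A: L(b^2a)\ge 0\text{ for all }b\in A\}$. *)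

theory Defs
  imports "HOL-Analysis.Analysis"
begin

definition characters :: "('a::{comm_ring_1,real_algebra_1} \<Rightarrow> real) set" where
  "characters =
     {\<alpha>. linear \<alpha> \<and> \<alpha> 1 = 1 \<and> (\<forall>a b. \<alpha> (a * b) = \<alpha> a * \<alpha> b)}"

text \<open>The type \<^typ>\<open>'a \<Rightarrow> real\<close> carries the product topology, so
  \<^term>\<open>top_of_set characters\<close> is the topology of pointwise convergence on the
  character space. A Radon measure is a locally finite Borel measure which is inner
  regular with respect to compact sets.\<close>

definition radon_measure_on :: "'b::topological_space set \<Rightarrow> 'b measure \<Rightarrow> bool" where
  "radon_measure_on X M \<longleftrightarrow>
     sets M = sets (restrict_space borel X) \<and>
     (\<forall>x\<in>X. \<exists>U. openin (top_of_set X) U \<and> x \<in> U \<and> emeasure M U < \<infinity>) \<and>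
     (\<forall>B\<in>sets M. emeasure M B = (SUP K\<in>{K. compact K \<and> K \<subseteq> B}. emeasure M K))"

definition measure_support :: "'b::topological_space measure \<Rightarrow> 'b set" where
  "measure_support M =
     {x \<in> space M. \<forall>U. openin (top_of_set (space M)) U \<and> x \<in> U \<longrightarrow> 0 < emeasure M U}"

text \<open>Integrability is required explicitly, because the Bochner integral of a
  non-integrable function is 0.\<close>

definition representing_measure ::
  "('a::{comm_ring_1,real_algebra_1} \<Rightarrow> real) \<Rightarrow> ('a \<Rightarrow> real) measure \<Rightarrow> bool" where
  "representing_measure L M \<longleftrightarrow>
     radon_measure_on characters M \<and>
     (\<forall>a. integrable M (\<lambda>\<alpha>. \<alpha> a) \<and> L a = (\<integral>\<alpha>. \<alpha> a \<partial>M))"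

definition positive_semidefinite :: "('a::{comm_ring_1,real_algebra_1} \<Rightarrow> real) \<Rightarrow> bool" where
  "positive_semidefinite L \<longleftrightarrow> (\<forall>a. 0 \<le> L (a\<^sup>2))"

definition Q_of :: "('a::{comm_ring_1,real_algebra_1} \<Rightarrow> real) \<Rightarrow> 'a set" where
  "Q_of L = {a. \<forall>b. 0 \<le> L (b\<^sup>2 * a)}"

definition C_of :: "('a::{comm_ring_1,real_algebra_1} \<Rightarrow> real) \<Rightarrow> 'a \<Rightarrow> ereal" where
  "C_of L a = (SUP n\<in>{1::nat..}. ereal (root (2 * n) (L (a ^ (2 * n)))))"

definition nonneg_characters :: "'a::{comm_ring_1,real_algebra_1} set \<Rightarrow> ('a \<Rightarrow> real) set" where
  "nonneg_characters Q = {\<alpha> \<in> characters. \<forall>q\<in>Q. 0 \<le> \<alpha> q}"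

end

theory Submission
  imports Defs
begin

text \<open>Assume first that every \<open>C_of L a\<close> is finite. Repeated use of the Cauchy--Schwarz inequality turns the
bound \<open>L (a ^ (2 * n)) \<le> C ^ (2 * n)\<close> into \<open>L (b\<^sup>2 * a\<^sup>2) \<le> C\<^sup>2 * L (b\<^sup>2)\<close> for all \<open>b\<close>
(\<open>square_bound_in_Q_of\<close>): in the pre-Hilbert space with inner product \<open>L (x * y)\<close>, multiplication by \<open>a\<close>
is an operator of norm at most \<open>C\<close>. So these multiplications are commuting bounded self-adjoint operators,
and \<open>Q_of L\<close> consists of the elements whose multiplication operator is positive. As products of commuting
positive operators are positive, \<open>Q_of L\<close> is closed under multiplication (\<open>Q_of_mult\<close>); it is thus an
Archimedean preordering, which also contains \<open>C - a\<close> and \<open>C + a\<close>.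

For such a preordering real algebra produces enough characters. An Archimedean preordering that
does not contain \<open>-1\<close> extends by Zorn's lemma to a total one, and a total one cuts the real line at one point for each
\<open>a\<close>, which defines a character (\<open>total_preordering_character\<close>). Let \<open>K\<close> be the set of characters that are
nonnegative on \<open>Q_of L\<close>. The elements \<open>C - a\<close> and \<open>C + a\<close> show that \<open>K\<close> lies in the box
\<open>\<bar>\<alpha> a\<bar> \<le> C_of L a\<close>, so \<open>K\<close> is compact, and every element that is positive on \<open>K\<close> lies in
\<open>Q_of L\<close> (\<open>positive_in_Q_of\<close>). Consequently \<open>L\<close> is a positive functional on the functions \<open>\<alpha> \<mapsto> \<alpha> a\<close> on \<open>K\<close>.

By the Stone--Weierstrass theorem these functions are dense in the continuous functions on any compact set \<open>S\<close>
of characters. This is what the construction of Riesz, Markov and Kakutani needs: the content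
\<open>C \<mapsto> inf {L a | a \<ge> 0 on S, a \<ge> 1 on C}\<close> of closed sets is additive on disjoint sets, and the outer measure
that it induces is a Radon measure on the Borel sets that represents \<open>L\<close>
(\<open>representing_measure_exists\<close>). Applied to \<open>S = K\<close> this gives a representing measure whose support lies in \<open>K\<close>,
and on \<open>K\<close> both \<open>\<bar>\<alpha> a\<bar> \<le> C_of L a\<close> and \<open>0 \<le> \<alpha> q\<close> for \<open>q \<in> Q \<subseteq> Q_of L\<close> hold.

Uniqueness comes from the same content. If \<open>S\<close> contains the compact support of a representing measure, then the
measure of a closed subset of \<open>S\<close> is its content (\<open>representing_measure_closed_eq_content\<close>), which depends on \<open>L\<close> and
\<open>S\<close> only. Two representing measures with compact support are compared on the union of their supports and agree on
compact sets, hence everywhere by inner regularity. In particular any representing measure with compact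
support is the constructed one, which yields the bound on its support.

The converse is integration over the support: there \<open>\<alpha> \<mapsto> \<alpha> a\<close> is bounded, so the moments \<open>L (a ^ (2 * n))\<close> grow at
most geometrically, and \<open>b\<^sup>2 * q\<close> is nonnegative there, so its integral is.\<close>

section \<open>Total preorderings and characters\<close>

lemma characters_linear: "\<alpha> \<in> characters \<Longrightarrow> linear \<alpha>"
  by (simp add: characters_def)

lemma characters_simps:
  assumes "\<alpha> \<in> characters"
  shows "\<alpha> (a + b) = \<alpha> a + \<alpha> b" "\<alpha> (a - b) = \<alpha> a - \<alpha> b" "\<alpha> (- a) = - \<alpha> a"
    "\<alpha> (a * b) = \<alpha> a * \<alpha> b" "\<alpha> 1 = 1" "\<alpha> 0 = 0" "\<alpha> (r *\<^sub>R a) = r * \<alpha> a"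
    "\<alpha> (of_real r) = r" "\<alpha> (a ^ n) = \<alpha> a ^ n"
proof -
  have lin: "linear \<alpha>" and one: "\<alpha> 1 = 1" and mult: "\<And>a b. \<alpha> (a * b) = \<alpha> a * \<alpha> b"
    using assms by (auto simp: characters_def)
  show "\<alpha> (a + b) = \<alpha> a + \<alpha> b" "\<alpha> (a - b) = \<alpha> a - \<alpha> b" "\<alpha> (- a) = - \<alpha> a"
    "\<alpha> 0 = 0" "\<alpha> (r *\<^sub>R a) = r * \<alpha> a"
    using lin by (simp_all add: linear_add linear_diff linear_neg linear_0 linear_scale)
  show "\<alpha> (of_real r) = r"
    using lin by (simp add: of_real_def linear_scale one)
  show "\<alpha> (a ^ n) = \<alpha> a ^ n"
    by (induction n) (simp_all add: one mult)
  show "\<alpha> (a * b) = \<alpha> a * \<alpha> b" "\<alpha> 1 = 1"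
    by (fact mult one)+
qed

text \<open>Every real number \<open>r \<ge> 0\<close> is the square of \<open>sqrt r\<close>, so in a real algebra a preordering contains the
nonnegative constants and is closed under nonnegative scaling.\<close>

definition preordering :: "'a::comm_ring_1 set \<Rightarrow> bool" where
  "preordering T \<longleftrightarrow> (\<forall>a. a\<^sup>2 \<in> T) \<and> (\<forall>a\<in>T. \<forall>b\<in>T. a + b \<in> T \<and> a * b \<in> T)"

lemma preorderingD:
  assumes "preordering T"
  shows "a\<^sup>2 \<in> T" "a \<in> T \<Longrightarrow> b \<in> T \<Longrightarrow> a + b \<in> T" "a \<in> T \<Longrightarrow> b \<in> T \<Longrightarrow> a * b \<in> T"
    "0 \<in> T" "1 \<in> T"
proof -
  show sq: "a\<^sup>2 \<in> T" for a using assms by (auto simp: preordering_def)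
  show "a \<in> T \<Longrightarrow> b \<in> T \<Longrightarrow> a + b \<in> T" "a \<in> T \<Longrightarrow> b \<in> T \<Longrightarrow> a * b \<in> T"
    using assms by (auto simp: preordering_def)
  show "0 \<in> T" "1 \<in> T" using sq[of 0] sq[of 1] by simp_all
qed

lemma preordering_of_real:
  fixes T :: "'a::{comm_ring_1,real_algebra_1} set"
  assumes "preordering T" "0 \<le> r"
  shows "of_real r \<in> T"
  using preorderingD(1)[OF assms(1), of "of_real (sqrt r)"] assms(2)
  by (simp flip: of_real_power)

lemma preordering_adjoin:
  assumes T: "preordering T"
  shows "preordering {s + a * t | s t. s \<in> T \<and> t \<in> T}"
    and "T \<subseteq> {s + a * t | s t. s \<in> T \<and> t \<in> T}"
    and "a \<in> {s + a * t | s t. s \<in> T \<and> t \<in> T}"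
proof -
  note D = preorderingD[OF T]
  show sub: "T \<subseteq> {s + a * t | s t. s \<in> T \<and> t \<in> T}"
    using D(4) by (force intro: exI[of _ 0])
  show "a \<in> {s + a * t | s t. s \<in> T \<and> t \<in> T}"
    using D(4,5) by (force intro: exI[of _ 0] exI[of _ 1])
  have add: "\<exists>s t. (s1 + a * t1) + (s2 + a * t2) = s + a * t \<and> s \<in> T \<and> t \<in> T"
    if "s1 \<in> T" "t1 \<in> T" "s2 \<in> T" "t2 \<in> T" for s1 t1 s2 t2
    using that by (intro exI[of _ "s1 + s2"] exI[of _ "t1 + t2"]) (auto simp: algebra_simps D)
  have mult: "\<exists>s t. (s1 + a * t1) * (s2 + a * t2) = s + a * t \<and> s \<in> T \<and> t \<in> T"
    if "s1 \<in> T" "t1 \<in> T" "s2 \<in> T" "t2 \<in> T" for s1 t1 s2 t2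
  proof (intro exI conjI)
    show "(s1 + a * t1) * (s2 + a * t2) = (s1 * s2 + a\<^sup>2 * (t1 * t2)) + a * (s1 * t2 + t1 * s2)"
      by (simp add: algebra_simps power2_eq_square)
    show "s1 * s2 + a\<^sup>2 * (t1 * t2) \<in> T" "s1 * t2 + t1 * s2 \<in> T"
      using that by (intro D; simp)+
  qed
  show "preordering {s + a * t | s t. s \<in> T \<and> t \<in> T}"
    unfolding preordering_def using sub D(1) add mult by blast
qed

text \<open>A preordering that is maximal among those without \<open>-1\<close> is total. If neither \<open>a\<close> nor \<open>-a\<close> belonged to it,
then adjoining either of them would produce \<open>-1 = s + a * t\<close> and \<open>-1 = s' - a * t'\<close>. Multiplying
\<open>1 + s = - (a * t)\<close> by \<open>1 + s' = a * t'\<close> writes \<open>-1\<close> as an element of the preordering.\<close>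

lemma preordering_total_extension:
  assumes T0: "preordering T0" "-1 \<notin> T0"
  obtains T where "T0 \<subseteq> T" "preordering T" "-1 \<notin> T" "\<And>a. a \<in> T \<or> - a \<in> T"
proof -
  let ?A = "{T. T0 \<subseteq> T \<and> preordering T \<and> -1 \<notin> T}"
  have "\<exists>M\<in>?A. \<forall>X\<in>?A. M \<subseteq> X \<longrightarrow> X = M"
  proof (rule subset_Zorn_nonempty)
    show "?A \<noteq> {}" using T0 by auto
  next
    fix C assume C: "C \<noteq> {}" "subset.chain ?A C"
    have sub: "C \<subseteq> ?A" and ch: "\<And>X Y. X \<in> C \<Longrightarrow> Y \<in> C \<Longrightarrow> X \<subseteq> Y \<or> Y \<subseteq> X"
      using C(2) by (auto simp: subset_chain_def)
    have "a + b \<in> \<Union>C \<and> a * b \<in> \<Union>C" if ab: "a \<in> \<Union>C" "b \<in> \<Union>C" for a b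
    proof -
      obtain X where X: "X \<in> C" "a \<in> X" "b \<in> X" using ab ch by blast
      then have "preordering X" using sub by auto
      then show ?thesis using X preorderingD(2,3) by blast
    qed
    moreover have "a\<^sup>2 \<in> \<Union>C" for a
      using C(1) sub preorderingD(1) by blast
    ultimately have "preordering (\<Union>C)" by (auto simp: preordering_def)
    then show "\<Union>C \<in> ?A" using C(1) sub by blast
  qed
  then obtain T where "T \<in> ?A" and max': "\<forall>X\<in>?A. T \<subseteq> X \<longrightarrow> X = T"
    by (elim bexE)
  then have T: "T0 \<subseteq> T" "preordering T" "-1 \<notin> T" by simp_all
  have max: "X = T" if "T0 \<subseteq> X" "preordering X" "-1 \<notin> X" "T \<subseteq> X" for X
    using max' that by simp
  note D = preorderingD[OF T(2)]
  have adj: "\<exists>s\<in>T. \<exists>t\<in>T. -1 = s + a * t" if "a \<notin> T" for a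
  proof (rule ccontr)
    let ?X = "{s + a * t | s t. s \<in> T \<and> t \<in> T}"
    assume "\<not> ?thesis"
    then have "-1 \<notin> ?X" by auto
    then have "?X = T" using max[of ?X] preordering_adjoin[OF T(2), of a] T(1) by auto
    then show False using preordering_adjoin(3)[OF T(2), of a] that by auto
  qed
  have "a \<in> T \<or> - a \<in> T" for a
  proof (rule ccontr)
    assume "\<not> ?thesis"
    then obtain s t s' t' where st: "s \<in> T" "t \<in> T" "s' \<in> T" "t' \<in> T"
      and eq: "-1 = s + a * t" "-1 = s' + (- a) * t'" using adj by meson
    have s: "s = -1 - a * t" unfolding eq(1) by simp
    have s': "s' = -1 - (- a) * t'" unfolding eq(2) by simp
    have "-1 = s + s' + s * s' + a\<^sup>2 * (t * t')"
      by (simp add: s s' algebra_simps power2_eq_square)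
    moreover have "s + s' + s * s' + a\<^sup>2 * (t * t') \<in> T" using st by (intro D)
    ultimately show False using T(3) by simp
  qed
  then show ?thesis using that T by blast
qed

text \<open>A total Archimedean preordering \<open>T\<close> splits the real numbers, for each \<open>a\<close>, into those \<open>r\<close> with \<open>a - r \<in> T\<close> and those
with \<open>r - a \<in> T\<close>. The cut point is the value of the character at \<open>a\<close>. Additivity and homogeneity are
read off from the cuts. Closure of \<open>T\<close> under products is used to see that \<open>\<alpha> a = 0\<close> implies \<open>\<alpha> (a\<^sup>2) = 0\<close>,
and polarization then gives multiplicativity.\<close>

lemma total_preordering_character:
  fixes T :: "'a::{comm_ring_1,real_algebra_1} set"
  assumes T: "preordering T" "-1 \<notin> T" "\<And>a. a \<in> T \<or> - a \<in> T"
    and arch: "\<And>a. \<exists>r. of_real r - a \<in> T"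
  obtains \<alpha> where "\<alpha> \<in> characters" "\<And>a. a \<in> T \<Longrightarrow> 0 \<le> \<alpha> a"
proof -
  note D = preorderingD[OF T(1)] and Dr = preordering_of_real[OF T(1)]
  have scale: "r *\<^sub>R a \<in> T" if "a \<in> T" "0 \<le> r" for a r
    using D(3)[OF Dr[OF that(2)] that(1)] by (simp add: of_real_def)
  have neg: "of_real r \<notin> T" if "r < 0" for r
  proof
    assume "of_real r \<in> T"
    from scale[OF this, of "- 1 / r"] that show False
      using T(2) by (simp add: scaleR_conv_of_real flip: of_real_mult)
  qed
  define \<alpha> where "\<alpha> a = Sup {r. a - of_real r \<in> T}" for a
  have bdd: "bdd_above {r. a - of_real r \<in> T}" for a
  proof -
    obtain N where N: "of_real N - a \<in> T" using arch by blast
    have "r \<le> N" if "a - of_real r \<in> T" for r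
    proof (rule ccontr)
      assume "\<not> r \<le> N"
      then have "of_real (N - r) \<notin> T" by (intro neg) simp
      moreover have "of_real (N - r) = (of_real N - a) + (a - of_real r)" by simp
      ultimately show False using D(2)[OF N that] by simp
    qed
    then show ?thesis by (auto simp: bdd_above_def)
  qed
  have ne: "{r. a - of_real r \<in> T} \<noteq> {}" for a
  proof -
    obtain N where "of_real N - (- a) \<in> T" using arch by blast
    then have "a - of_real (- N) \<in> T" by (simp add: algebra_simps)
    then show ?thesis by blast
  qed
  have lo: "a - of_real r \<in> T" if r: "r < \<alpha> a" for a r
  proof -
    obtain s where s: "a - of_real s \<in> T" "r < s"
      using less_cSupD[OF ne r[unfolded \<alpha>_def]] by auto
    have "(a - of_real s) + of_real (s - r) \<in> T" using s by (intro D Dr) auto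
    then show ?thesis by simp
  qed
  have ge: "r \<le> \<alpha> a" if "a - of_real r \<in> T" for a r
    unfolding \<alpha>_def using that bdd by (intro cSup_upper) auto
  have hi: "of_real r - a \<in> T" if "\<alpha> a < r" for a r
    using T(3)[of "a - of_real r"] ge[of a r] that by auto
  have le: "\<alpha> a \<le> r" if r: "of_real r - a \<in> T" for a r
  proof (rule ccontr)
    assume "\<not> ?thesis"
    then obtain s where s: "r < s" "s < \<alpha> a" using dense not_le by metis
    have "(of_real r - a) + (a - of_real s) \<in> T" using r lo s by (intro D) auto
    then show False using neg[of "r - s"] s by simp
  qed
  have eqI: "\<alpha> a = x" if "\<And>e. e > 0 \<Longrightarrow> a - of_real (x - e) \<in> T"
      "\<And>e. e > 0 \<Longrightarrow> of_real (x + e) - a \<in> T" for a x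
  proof (rule antisym)
    show "\<alpha> a \<le> x" by (rule field_le_epsilon) (use that le in blast)
    show "x \<le> \<alpha> a" by (rule field_le_epsilon) (use that(1)[THEN ge] in \<open>simp add: algebra_simps\<close>)
  qed
  have lo': "a - of_real (\<alpha> a - e) \<in> T" and hi': "of_real (\<alpha> a + e) - a \<in> T" if "e > 0" for a e
    using that by (intro lo hi; simp)+
  have add: "\<alpha> (a + b) = \<alpha> a + \<alpha> b" for a b
  proof (rule eqI)
    fix e :: real assume "e > 0"
    then have "(a - of_real (\<alpha> a - e/2)) + (b - of_real (\<alpha> b - e/2)) \<in> T"
      "(of_real (\<alpha> a + e/2) - a) + (of_real (\<alpha> b + e/2) - b) \<in> T"
      using lo' hi' by (intro D; simp)+
    moreover have "(a - of_real (\<alpha> a - e/2)) + (b - of_real (\<alpha> b - e/2))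
        = a + b - (of_real ((\<alpha> a - e/2) + (\<alpha> b - e/2)) :: 'a)"
      "(of_real (\<alpha> a + e/2) - a) + (of_real (\<alpha> b + e/2) - b)
        = (of_real ((\<alpha> a + e/2) + (\<alpha> b + e/2)) :: 'a) - (a + b)"
      by (simp_all only: of_real_add of_real_diff algebra_simps)
    moreover have "(\<alpha> a - e/2) + (\<alpha> b - e/2) = \<alpha> a + \<alpha> b - e"
      "(\<alpha> a + e/2) + (\<alpha> b + e/2) = \<alpha> a + \<alpha> b + e" by simp_all
    ultimately show "a + b - of_real (\<alpha> a + \<alpha> b - e) \<in> T" "of_real (\<alpha> a + \<alpha> b + e) - (a + b) \<in> T"
      by metis+
  qed
  have const: "\<alpha> (of_real r) = r" for r
    by (rule eqI) (simp_all add: Dr flip: of_real_diff)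
  have minus: "\<alpha> (- a) = - \<alpha> a" for a
    using add[of a "- a"] const[of 0] by simp
  have scale_pos: "\<alpha> (r *\<^sub>R a) = r * \<alpha> a" if r: "r > 0" for r a
  proof (rule eqI)
    fix e :: real assume "e > 0"
    then have "r *\<^sub>R (a - of_real (\<alpha> a - e/r)) \<in> T" "r *\<^sub>R (of_real (\<alpha> a + e/r) - a) \<in> T"
      using r by (intro scale lo' hi'; simp)+
    then show "r *\<^sub>R a - of_real (r * \<alpha> a - e) \<in> T" "of_real (r * \<alpha> a + e) - r *\<^sub>R a \<in> T"
      using r by (simp_all add: of_real_def scaleR_diff_right scaleR_add_right scaleR_diff_left
          scaleR_add_left)
  qed
  have scaleR: "\<alpha> (r *\<^sub>R a) = r * \<alpha> a" for r a
  proof (cases "r = 0")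
    case True then show ?thesis using const[of 0] by simp
  next
    case False
    then show ?thesis
      using scale_pos[of r a] scale_pos[of "- r" a] minus[of "r *\<^sub>R a"] by (cases "r > 0") auto
  qed
  have sq0: "\<alpha> (a\<^sup>2) = 0" if a: "\<alpha> a = 0" for a
  proof (rule eqI)
    fix e :: real assume e: "e > 0"
    have "a\<^sup>2 + of_real e \<in> T" using e by (intro D Dr) auto
    then show "a\<^sup>2 - of_real (0 - e) \<in> T" by simp
    have "(a - of_real (0 - sqrt e)) * (of_real (0 + sqrt e) - a) \<in> T"
      using lo'[of "sqrt e" a] hi'[of "sqrt e" a] e a by (intro D) auto
    moreover have "of_real (sqrt e) * of_real (sqrt e) = (of_real e :: 'a)"
      using e by (simp flip: of_real_mult)
    then have "(a - of_real (0 - sqrt e)) * (of_real (0 + sqrt e) - a) = of_real (0 + e) - a\<^sup>2"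
      by (simp add: algebra_simps power2_eq_square)
    ultimately show "of_real (0 + e) - a\<^sup>2 \<in> T" by simp
  qed
  have sq: "\<alpha> (a\<^sup>2) = (\<alpha> a)\<^sup>2" for a
  proof -
    define a0 where "a0 = a - of_real (\<alpha> a)"
    have a0: "\<alpha> a0 = 0"
      using add[of a "- of_real (\<alpha> a)"] by (simp add: a0_def minus const)
    have "a\<^sup>2 = a0\<^sup>2 + ((2 * \<alpha> a) *\<^sub>R a0 + of_real ((\<alpha> a)\<^sup>2))"
      by (simp add: a0_def scaleR_conv_of_real algebra_simps power2_eq_square)
    then show ?thesis using a0 by (simp add: add scaleR const sq0[OF a0] del: of_real_power)
  qed
  have mult: "\<alpha> (a * b) = \<alpha> a * \<alpha> b" for a b
  proof -
    have "\<alpha> ((a + b)\<^sup>2) = \<alpha> (a\<^sup>2 + (2 *\<^sub>R (a * b) + b\<^sup>2))"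
      by (simp add: power2_eq_square algebra_simps scaleR_2)
    then have "(\<alpha> a + \<alpha> b)\<^sup>2 = (\<alpha> a)\<^sup>2 + (2 * \<alpha> (a * b) + (\<alpha> b)\<^sup>2)"
      by (simp only: sq add scaleR)
    then show ?thesis by (simp add: power2_eq_square algebra_simps)
  qed
  show ?thesis
  proof
    show "\<alpha> \<in> characters"
      unfolding characters_def using const[of 1] by (auto intro!: linearI add scaleR mult)
    show "0 \<le> \<alpha> a" if "a \<in> T" for a using ge[of a 0] that by simp
  qed
qed

section \<open>Positivity on the cone Q_L\<close>

lemma Q_ofD: "a \<in> Q_of L \<Longrightarrow> 0 \<le> L (b\<^sup>2 * a)"
  by (simp add: Q_of_def)

lemma Q_of_add:
  assumes "linear L" "a \<in> Q_of L" "b \<in> Q_of L"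
  shows "a + b \<in> Q_of L"
  using assms by (simp add: Q_of_def distrib_left linear_add)

lemma Q_of_square_mult:
  assumes "a \<in> Q_of L"
  shows "c\<^sup>2 * a \<in> Q_of L"
  using assms Q_ofD[of a L "_ * c"] by (auto simp: Q_of_def power_mult_distrib mult.assoc)

lemma Q_of_square:
  assumes "positive_semidefinite L"
  shows "c\<^sup>2 \<in> Q_of L"
  using assms by (auto simp: Q_of_def positive_semidefinite_def simp flip: power_mult_distrib)

lemma Q_of_scaleR:
  assumes "linear L" "a \<in> Q_of L" "0 \<le> r"
  shows "r *\<^sub>R a \<in> Q_of L"
  using assms by (simp add: Q_of_def linear_scale)

lemma Q_of_of_real:
  assumes "positive_semidefinite L" "0 \<le> r"
  shows "of_real r \<in> Q_of L"
  using Q_of_square[OF assms(1), of "of_real (sqrt r)"] assms(2) by (simp flip: of_real_power)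

lemma Cauchy_Schwarz_psd:
  assumes lin: "linear L" and psd: "positive_semidefinite L"
  shows "(L (x * y))\<^sup>2 \<le> L (x\<^sup>2) * L (y\<^sup>2)"
proof -
  define p q r where "p = L (x\<^sup>2)" and "q = L (x * y)" and "r = L (y\<^sup>2)"
  have nonneg: "0 \<le> p" "0 \<le> r"
    using psd by (auto simp: p_def r_def positive_semidefinite_def)
  have quad: "0 \<le> s\<^sup>2 * p - 2 * s * t * q + t\<^sup>2 * r" for s t
  proof -
    have "(s *\<^sub>R x - t *\<^sub>R y)\<^sup>2 = s\<^sup>2 *\<^sub>R x\<^sup>2 - (2 * s * t) *\<^sub>R (x * y) + t\<^sup>2 *\<^sub>R y\<^sup>2"
      by (simp add: scaleR_conv_of_real power2_eq_square algebra_simps)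
    then have "L ((s *\<^sub>R x - t *\<^sub>R y)\<^sup>2) = s\<^sup>2 * p - 2 * s * t * q + t\<^sup>2 * r"
      using lin by (simp add: linear_add linear_diff linear_scale p_def q_def r_def)
    then show ?thesis using psd unfolding positive_semidefinite_def by metis
  qed
  have "q\<^sup>2 \<le> p * r"
  proof -
    consider "r > 0" | "p > 0" | "p = 0" "r = 0" using nonneg by linarith
    then show ?thesis
    proof cases
      case 1
      have "0 \<le> r * (p * r - q\<^sup>2)"
        using quad[of r q] by (simp add: power2_eq_square algebra_simps)
      with 1 show ?thesis by (simp add: zero_le_mult_iff)
    next
      case 2
      have "0 \<le> p * (p * r - q\<^sup>2)"
        using quad[of q p] by (simp add: power2_eq_square algebra_simps)
      with 2 show ?thesis by (simp add: zero_le_mult_iff)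
    next
      case 3
      then show ?thesis using quad[of 1 1] quad[of 1 "-1"] by simp
    qed
  qed
  then show ?thesis by (simp add: p_def q_def r_def)
qed

text \<open>Exponents that are powers of two suffice here because iterating the Cauchy--Schwarz inequality
doubles the exponent at each step.\<close>

lemma le_if_powers_le:
  fixes x y D :: real
  assumes y: "0 \<le> y" and *: "\<And>k::nat. x ^ (2 ^ Suc k) \<le> D * y ^ (2 ^ Suc k)"
  shows "x \<le> y"
proof (rule ccontr)
  assume "\<not> x \<le> y"
  then have xy: "y < x" by simp
  show False
  proof (cases "y = 0")
    case True
    then show False using *[of 0] xy by simp
  next
    case False
    then have y: "0 < y" and "1 < x / y" using y xy by simp_all
    then obtain n where n: "D < (x / y) ^ n" using real_arch_pow by blast
    also have "\<dots> \<le> (x / y) ^ (2 ^ Suc n)"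
      using \<open>1 < x / y\<close> less_exp[of "Suc n"] by (intro power_increasing) auto
    also have "\<dots> \<le> D" using *[of n] y by (simp add: power_divide divide_simps)
    finally show False by simp
  qed
qed

lemma moment_le_C_of:
  assumes psd: "positive_semidefinite L" and C: "C_of L a = ereal c" and n: "n \<ge> 1"
  shows "L (a ^ (2 * n)) \<le> c ^ (2 * n)"
proof -
  have L: "0 \<le> L (a ^ (2 * n))"
    using psd unfolding positive_semidefinite_def by (metis mult.commute power_mult)
  have "ereal (root (2 * n) (L (a ^ (2 * n)))) \<le> ereal c"
    unfolding C[symmetric] C_of_def using n by (intro SUP_upper) auto
  then have "root (2 * n) (L (a ^ (2 * n))) ^ (2 * n) \<le> c ^ (2 * n)"
    using n L by (intro power_mono) (auto simp: real_root_ge_zero)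
  then show ?thesis using n L by (simp add: real_root_pow_pos2)
qed

lemma C_of_nonneg:
  assumes psd: "positive_semidefinite L"
  shows "0 \<le> C_of L a"
proof -
  have "0 \<le> L (a ^ (2 * 1))" using psd by (simp add: positive_semidefinite_def)
  then have "0 \<le> ereal (root (2 * 1) (L (a ^ (2 * 1))))"
    by (simp del: mult_1_right)
  also have "\<dots> \<le> C_of L a" unfolding C_of_def by (intro SUP_upper) auto
  finally show ?thesis .
qed

lemma C_of_finiteE:
  assumes "positive_semidefinite L" "C_of L a < \<infinity>"
  obtains c where "C_of L a = ereal c" "0 \<le> c"
  using assms C_of_nonneg[of L a] by (cases "C_of L a") auto

text \<open>Write \<open>m n = L (b\<^sup>2 * a ^ (2 * n))\<close>. The Cauchy--Schwarz inequality for \<open>b\<close> and \<open>b * a ^ (2 * j)\<close> gives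
\<open>(m j)\<^sup>2 \<le> m 0 * m (2 * j)\<close>, so \<open>m 1 / m 0\<close> is at most the \<open>2 ^ k\<close>-th root of \<open>m (2 ^ k) / m 0\<close>. A second
application, to \<open>b\<^sup>2\<close> and \<open>a ^ (2 * n)\<close>, separates \<open>b\<close> from \<open>a\<close> and bounds \<open>(m n)\<^sup>2\<close> by \<open>c ^ (4 * n)\<close> up to a
factor independent of \<open>n\<close>, and this factor disappears in the limit of the roots.\<close>

lemma square_bound_in_Q_of:
  assumes lin: "linear L" and psd: "positive_semidefinite L" and C: "C_of L a = ereal c"
  shows "of_real (c\<^sup>2) - a\<^sup>2 \<in> Q_of L"
proof -
  have "L (b\<^sup>2 * a\<^sup>2) \<le> c\<^sup>2 * L (b\<^sup>2)" for b
  proof -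
    define m where "m n = L (b\<^sup>2 * a ^ (2 * n))" for n
    have m_nonneg: "0 \<le> m n" for n
    proof -
      have "b\<^sup>2 * a ^ (2 * n) = (b * a ^ n)\<^sup>2"
        by (simp add: power_mult_distrib mult.commute flip: power_mult)
      then show ?thesis using psd by (simp add: m_def positive_semidefinite_def)
    qed
    have m_sq: "(m j)\<^sup>2 \<le> m 0 * m (2 * j)" for j
      using Cauchy_Schwarz_psd[OF lin psd, of b "b * a ^ (2 * j)"]
      by (simp add: m_def power2_eq_square mult.left_commute mult.assoc flip: power_add)
    have m_bound: "(m n)\<^sup>2 \<le> L (b ^ 4) * (c\<^sup>2) ^ (2 * n)" if "n \<ge> 1" for n
    proof -
      have "(m n)\<^sup>2 \<le> L ((b\<^sup>2)\<^sup>2) * L ((a ^ (2 * n))\<^sup>2)"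
        unfolding m_def by (rule Cauchy_Schwarz_psd[OF lin psd])
      also have "(b\<^sup>2)\<^sup>2 = b ^ 4" by (simp flip: power_mult)
      also have "(a ^ (2 * n))\<^sup>2 = a ^ (2 * (2 * n))" by (simp add: mult_ac flip: power_mult)
      also have "L (b ^ 4) * L (a ^ (2 * (2 * n))) \<le> L (b ^ 4) * c ^ (2 * (2 * n))"
        using that psd[unfolded positive_semidefinite_def, rule_format, of "b\<^sup>2"]
        by (intro mult_left_mono moment_le_C_of[OF psd C]) (auto simp flip: power_mult)
      finally show ?thesis by (simp add: power_mult)
    qed
    show ?thesis
    proof (cases "m 0 = 0")
      case True
      then show ?thesis using m_sq[of 1] by (simp add: m_def)
    next
      case False
      then have m0: "m 0 > 0" using m_nonneg[of 0] by simp
      define t where "t n = m n / m 0" for n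
      have t_sq: "(t j)\<^sup>2 \<le> t (2 * j)" for j
        using m_sq[of j] m0 by (simp add: t_def power_divide divide_simps power2_eq_square mult_ac)
      have t_nonneg: "0 \<le> t n" for n using m_nonneg m0 by (simp add: t_def)
      have t_pow: "t 1 ^ (2 ^ k) \<le> t (2 ^ k)" for k
      proof (induction k)
        case (Suc k)
        have "t 1 ^ (2 ^ Suc k) = (t 1 ^ (2 ^ k))\<^sup>2" by (simp add: mult.commute flip: power_mult)
        also have "\<dots> \<le> (t (2 ^ k))\<^sup>2" using Suc t_nonneg by (intro power_mono) auto
        also have "\<dots> \<le> t (2 ^ Suc k)" using t_sq[of "2 ^ k"] by simp
        finally show ?case .
      qed simp
      have "t 1 \<le> c\<^sup>2"
      proof (rule le_if_powers_le)
        fix k :: nat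
        have "t 1 ^ (2 ^ Suc k) = (t 1 ^ (2 ^ k))\<^sup>2" by (simp add: mult.commute flip: power_mult)
        also have "\<dots> \<le> (t (2 ^ k))\<^sup>2" using t_pow t_nonneg by (intro power_mono) auto
        also have "\<dots> \<le> (L (b ^ 4) / (m 0)\<^sup>2) * (c\<^sup>2) ^ (2 ^ Suc k)"
          using m_bound[of "2 ^ k"] m0 by (simp add: t_def power_divide divide_simps)
        finally show "t 1 ^ (2 ^ Suc k) \<le> (L (b ^ 4) / (m 0)\<^sup>2) * (c\<^sup>2) ^ (2 ^ Suc k)" .
      qed simp
      then show ?thesis using m0 by (simp add: t_def m_def divide_simps mult_ac)
    qed
  qed
  moreover have "L (b\<^sup>2 * (of_real (c\<^sup>2) - a\<^sup>2)) = c\<^sup>2 * L (b\<^sup>2) - L (b\<^sup>2 * a\<^sup>2)" for b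
  proof -
    have "b\<^sup>2 * (of_real (c\<^sup>2) - a\<^sup>2) = c\<^sup>2 *\<^sub>R b\<^sup>2 - b\<^sup>2 * a\<^sup>2"
      by (simp add: scaleR_conv_of_real algebra_simps)
    then show ?thesis using lin by (simp add: linear_diff linear_scale)
  qed
  ultimately show ?thesis by (simp add: Q_of_def)
qed

lemma bound_in_Q_of:
  assumes lin: "linear L" and psd: "positive_semidefinite L"
    and C: "C_of L a = ereal c" "0 \<le> c"
  shows "of_real c - a \<in> Q_of L" "of_real c + a \<in> Q_of L"
proof -
  have abs: "\<bar>L (b\<^sup>2 * a)\<bar> \<le> c * L (b\<^sup>2)" for b
  proof -
    have L: "0 \<le> L (b\<^sup>2)" using psd by (simp add: positive_semidefinite_def)
    have "(L (b\<^sup>2 * a))\<^sup>2 = (L (b * (b * a)))\<^sup>2" by (simp add: power2_eq_square mult.assoc)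
    also have "\<dots> \<le> L (b\<^sup>2) * L ((b * a)\<^sup>2)" by (rule Cauchy_Schwarz_psd[OF lin psd])
    also have "\<dots> \<le> L (b\<^sup>2) * (c\<^sup>2 * L (b\<^sup>2))"
    proof (rule mult_left_mono[OF _ L])
      have "0 \<le> L (b\<^sup>2 * (of_real (c\<^sup>2) - a\<^sup>2))"
        by (rule Q_ofD[OF square_bound_in_Q_of[OF lin psd C(1)]])
      also have "b\<^sup>2 * (of_real (c\<^sup>2) - a\<^sup>2) = c\<^sup>2 *\<^sub>R b\<^sup>2 - (b * a)\<^sup>2"
        by (simp add: scaleR_conv_of_real algebra_simps power_mult_distrib)
      finally show "L ((b * a)\<^sup>2) \<le> c\<^sup>2 * L (b\<^sup>2)"
        using lin by (simp add: linear_diff linear_scale)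
    qed
    finally have "(L (b\<^sup>2 * a))\<^sup>2 \<le> (c * L (b\<^sup>2))\<^sup>2" by (simp add: power2_eq_square mult_ac)
    then have "\<bar>L (b\<^sup>2 * a)\<bar> \<le> \<bar>c * L (b\<^sup>2)\<bar>" by (simp only: abs_le_square_iff)
    also have "\<dots> = c * L (b\<^sup>2)" using L C(2) by simp
    finally show ?thesis .
  qed
  have eq: "L (b\<^sup>2 * (of_real c + s *\<^sub>R a)) = c * L (b\<^sup>2) + s * L (b\<^sup>2 * a)" for b s
  proof -
    have "b\<^sup>2 * (of_real c + s *\<^sub>R a) = c *\<^sub>R b\<^sup>2 + s *\<^sub>R (b\<^sup>2 * a)"
      by (simp add: scaleR_conv_of_real algebra_simps)
    then show ?thesis using lin by (simp add: linear_add linear_scale)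
  qed
  have "0 \<le> L (b\<^sup>2 * (of_real c + s *\<^sub>R a))" if "\<bar>s\<bar> = 1" for b s
  proof -
    have "\<bar>s * L (b\<^sup>2 * a)\<bar> \<le> c * L (b\<^sup>2)" using abs[of b] that by (simp add: abs_mult)
    then show ?thesis unfolding eq by linarith
  qed
  from this[of "-1"] this[of 1] show "of_real c - a \<in> Q_of L" "of_real c + a \<in> Q_of L"
    by (simp_all add: Q_of_def)
qed

text \<open>This is F. Riesz's proof that a product of commuting positive operators is positive. Scale \<open>a\<close> to
\<open>s 0\<close> with \<open>0 \<le> s 0 \<le> 1\<close> in the order of \<open>Q_of L\<close>, and let \<open>s (n + 1) = s n - (s n)\<^sup>2\<close>, which stays in
the same range. Then \<open>s 0\<close> is the sum of the squares \<open>(s k)\<^sup>2\<close> for \<open>k < n\<close> plus a remainder \<open>s n\<close>. The squares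
contribute nonnegative terms to \<open>L (x\<^sup>2 * (s 0 * b))\<close>. The same telescoping with \<open>b = 1\<close> shows that
\<open>L ((x * s k)\<^sup>2)\<close> is summable in \<open>k\<close>, so the remainder tends to \<open>0\<close> by the Cauchy--Schwarz inequality.\<close>

lemma Q_of_mult:
  assumes lin: "linear L" and psd: "positive_semidefinite L"
    and C: "\<And>a. C_of L a < \<infinity>" and a: "a \<in> Q_of L" and b: "b \<in> Q_of L"
  shows "a * b \<in> Q_of L"
proof -
  obtain c where c: "C_of L a = ereal c" "0 \<le> c" by (rule C_of_finiteE[OF psd C])
  \<comment> \<open>The summand 1 keeps \<open>N\<close> positive when \<open>c = 0\<close>.\<close>
  define N where "N = c + 1"
  have N: "0 < N" using c by (simp add: N_def)
  have "(of_real c - a) + of_real 1 \<in> Q_of L"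
    by (intro Q_of_add lin bound_in_Q_of(1)[OF lin psd c] Q_of_of_real psd) simp
  then have Na: "of_real N - a \<in> Q_of L" by (simp add: N_def algebra_simps)
  define s where "s = rec_nat ((1 / N) *\<^sub>R a) (\<lambda>_ x. x - x\<^sup>2)"
  have s0: "s 0 = (1 / N) *\<^sub>R a" and sS: "s (Suc n) = s n - (s n)\<^sup>2" for n
    by (simp_all add: s_def)
  have sQ: "s n \<in> Q_of L \<and> 1 - s n \<in> Q_of L" for n
  proof (induction n)
    case 0
    have "1 - s 0 = (1 / N) *\<^sub>R (of_real N - a)"
      using N by (simp add: s0 scaleR_diff_right of_real_def)
    then show ?case using N a Na by (auto simp: s0 intro!: Q_of_scaleR lin)
  next
    case (Suc n)
    have "s (Suc n) = (s n)\<^sup>2 * (1 - s n) + (1 - s n)\<^sup>2 * s n"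
      by (simp add: sS power2_eq_square algebra_simps)
    moreover have "(s n)\<^sup>2 * (1 - s n) + (1 - s n)\<^sup>2 * s n \<in> Q_of L"
      using Suc by (intro Q_of_add lin Q_of_square_mult) auto
    moreover have "1 - s (Suc n) = (1 - s n) + (s n)\<^sup>2" by (simp add: sS)
    moreover have "(1 - s n) + (s n)\<^sup>2 \<in> Q_of L"
      using Suc by (intro Q_of_add lin Q_of_square psd) auto
    ultimately show ?case by (simp only: simp_thms)
  qed
  have "0 \<le> L (x\<^sup>2 * (s 0 * b))" for x
  proof -
    have step: "L (x\<^sup>2 * (s n * y)) = L ((x * s n)\<^sup>2 * y) + L (x\<^sup>2 * (s (Suc n) * y))" for n y
    proof -
      have "x\<^sup>2 * (s n * y) = (x * s n)\<^sup>2 * y + x\<^sup>2 * (s (Suc n) * y)"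
        by (simp add: sS power2_eq_square algebra_simps)
      then show ?thesis using lin by (simp add: linear_add)
    qed
    have telescope: "L (x\<^sup>2 * (s 0 * y)) = (\<Sum>k<n. L ((x * s k)\<^sup>2 * y)) + L (x\<^sup>2 * (s n * y))" for n y
    proof (induction n)
      case (Suc n)
      then show ?case using step[of n y] by simp
    qed simp
    have "(\<Sum>k<n. L ((x * s k)\<^sup>2)) \<le> L (x\<^sup>2 * s 0)" for n
      using telescope[of 1 n] Q_ofD[of "s n" L x] sQ[of n] by simp
    then have "summable (\<lambda>k. L ((x * s k)\<^sup>2))"
      using psd by (intro summableI_nonneg_bounded) (auto simp: positive_semidefinite_def)
    then have "(\<lambda>k. L ((x * s k)\<^sup>2)) \<longlonglongrightarrow> 0" by (rule summable_LIMSEQ_zero)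
    then have lim: "(\<lambda>k. L ((x * s k)\<^sup>2) * L ((x * b)\<^sup>2)) \<longlonglongrightarrow> 0" by (rule tendsto_mult_left_zero)
    have "(\<lambda>k. (L (x\<^sup>2 * (s k * b)))\<^sup>2) \<longlonglongrightarrow> 0"
    proof (rule Lim_null_comparison[OF always_eventually lim], rule allI)
      fix k
      have "(L (x\<^sup>2 * (s k * b)))\<^sup>2 = (L ((x * s k) * (x * b)))\<^sup>2"
        by (simp add: power2_eq_square mult_ac)
      also have "\<dots> \<le> L ((x * s k)\<^sup>2) * L ((x * b)\<^sup>2)" by (rule Cauchy_Schwarz_psd[OF lin psd])
      finally show "norm ((L (x\<^sup>2 * (s k * b)))\<^sup>2) \<le> L ((x * s k)\<^sup>2) * L ((x * b)\<^sup>2)"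
        by simp
    qed
    then have "(\<lambda>k. L (x\<^sup>2 * (s k * b))) \<longlonglongrightarrow> 0" by (simp add: power_tendsto_0_iff)
    moreover have "L (x\<^sup>2 * (s n * b)) \<le> L (x\<^sup>2 * (s 0 * b))" for n
      using telescope[of b n] Q_ofD[OF b] by (simp add: sum_nonneg)
    ultimately show ?thesis by (intro LIMSEQ_le_const2) auto
  qed
  then have "s 0 * b \<in> Q_of L" by (simp add: Q_of_def)
  then have "N *\<^sub>R (s 0 * b) \<in> Q_of L" using N by (intro Q_of_scaleR lin) auto
  then show ?thesis using N by (simp add: s0)
qed

lemma preordering_Q_of:
  assumes "linear L" "positive_semidefinite L" "\<And>a. C_of L a < \<infinity>"
  shows "preordering (Q_of L)"
  using assms by (auto simp: preordering_def intro: Q_of_square Q_of_add Q_of_mult)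

definition Q_characters :: "('a::{comm_ring_1,real_algebra_1} \<Rightarrow> real) \<Rightarrow> ('a \<Rightarrow> real) set" where
  "Q_characters L = {\<alpha> \<in> characters. \<forall>q\<in>Q_of L. 0 \<le> \<alpha> q}"

lemma Q_characters_bound:
  assumes "linear L" "positive_semidefinite L" "C_of L a < \<infinity>" "\<alpha> \<in> Q_characters L"
  shows "ereal \<bar>\<alpha> a\<bar> \<le> C_of L a"
proof -
  obtain c where c: "C_of L a = ereal c" "0 \<le> c" using C_of_finiteE[OF assms(2,3)] .
  have \<alpha>: "\<alpha> \<in> characters" "\<And>q. q \<in> Q_of L \<Longrightarrow> 0 \<le> \<alpha> q"
    using assms(4) by (auto simp: Q_characters_def)
  show ?thesis
    using \<alpha>(2)[OF bound_in_Q_of(1)[OF assms(1,2) c]] \<alpha>(2)[OF bound_in_Q_of(2)[OF assms(1,2) c]]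
    by (simp add: characters_simps[OF \<alpha>(1)] c)
qed

text \<open>If \<open>-1\<close> were not in the preordering generated by \<open>Q_of L\<close> and \<open>-a\<close>, then a total extension would provide a
character in \<open>Q_characters L\<close> with \<open>\<alpha> a \<le> 0\<close>. So \<open>a * t - 1 \<in> Q_of L\<close> for some \<open>t \<in> Q_of L\<close>. To remove \<open>t\<close>, choose
\<open>N > 0\<close> with \<open>N - t \<in> Q_of L\<close>. If \<open>a + r \<in> Q_of L\<close> with \<open>r \<ge> 0\<close>, then the identity
\<open>N * (a + r) - 1 = (N - t) * (a + r) + (a * t - 1) + r * t\<close> shows \<open>a + r - 1 / N \<in> Q_of L\<close>. Starting from a large
multiple of \<open>1 / N\<close>, this descends to \<open>r = 0\<close>.\<close>

lemma positive_in_Q_of: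
  assumes lin: "linear L" and psd: "positive_semidefinite L" and C: "\<And>a. C_of L a < \<infinity>"
    and pos: "\<And>\<alpha>. \<alpha> \<in> Q_characters L \<Longrightarrow> 0 < \<alpha> a"
  shows "a \<in> Q_of L"
proof -
  note P = preordering_Q_of[OF lin psd C]
  note D = preorderingD[OF P] and Dr = preordering_of_real[OF P]
  let ?T = "{s + (- a) * t | s t. s \<in> Q_of L \<and> t \<in> Q_of L}"
  have bound: "\<exists>r>0. of_real r - b \<in> Q_of L" for b
  proof -
    obtain c where c: "C_of L b = ereal c" "0 \<le> c" by (rule C_of_finiteE[OF psd C])
    have "(of_real c - b) + of_real 1 \<in> Q_of L"
      by (intro D(2) bound_in_Q_of(1)[OF lin psd c] Dr) simp
    then show ?thesis using c by (intro exI[of _ "c + 1"]) (simp add: algebra_simps)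
  qed
  have "-1 \<in> ?T"
  proof (rule ccontr)
    assume neg: "-1 \<notin> ?T"
    obtain T where T: "?T \<subseteq> T" "preordering T" "-1 \<notin> T" "\<And>a. a \<in> T \<or> - a \<in> T"
      by (rule preordering_total_extension[OF preordering_adjoin(1)[OF P] neg]) blast
    have QT: "Q_of L \<subseteq> T" using preordering_adjoin(2)[OF P, of "- a"] T(1) by simp
    obtain \<alpha> where \<alpha>: "\<alpha> \<in> characters" "\<And>a. a \<in> T \<Longrightarrow> 0 \<le> \<alpha> a"
    proof (rule total_preordering_character[OF T(2-4)])
      show "\<exists>r. of_real r - b \<in> T" for b using bound QT by blast
    qed blast
    have "0 < \<alpha> a" using pos \<alpha> QT by (auto simp: Q_characters_def)
    moreover have "0 \<le> \<alpha> (- a)"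
      using preordering_adjoin(3)[OF P, of "- a"] T(1) by (intro \<alpha>(2)) auto
    ultimately show False by (simp add: characters_simps[OF \<alpha>(1)])
  qed
  then obtain s t where st: "s \<in> Q_of L" "t \<in> Q_of L" "-1 = s + (- a) * t" by auto
  have at: "a * t - 1 \<in> Q_of L"
  proof -
    have "a * t - 1 = a * t + - 1" by simp
    also have "\<dots> = s" unfolding st(3) by simp
    finally have "a * t - 1 = s" .
    then show ?thesis using st(1) by simp
  qed
  obtain N where N: "0 < N" "of_real N - t \<in> Q_of L" using bound by blast
  obtain R where R: "of_real R - (- a) \<in> Q_of L" using bound by blast
  have step: "a + of_real (r - 1 / N) \<in> Q_of L" if r: "0 \<le> r" "a + of_real r \<in> Q_of L" for r
  proof -
    have "(of_real N - t) * (a + of_real r) + ((a * t - 1) + of_real r * t) \<in> Q_of L"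
      by (rule D(2)[OF D(3)[OF N(2) r(2)] D(2)[OF at D(3)[OF Dr[OF r(1)] st(2)]]])
    also have "(of_real N - t) * (a + of_real r) + ((a * t - 1) + of_real r * t)
        = of_real N * (a + of_real r) - 1"
      by (simp add: algebra_simps)
    finally have "(1 / N) *\<^sub>R (of_real N * (a + of_real r) - 1) \<in> Q_of L"
      using N by (intro Q_of_scaleR lin) auto
    also have "(1 / N) *\<^sub>R (of_real N * (a + of_real r) - 1) = a + of_real (r - 1 / N)"
      using N by (simp add: of_real_def scaleR_diff_right scaleR_diff_left)
    finally show ?thesis .
  qed
  obtain k :: nat where k: "R * N \<le> real k" using real_arch_simple by blast
  have "a + of_real (real j / N) \<in> Q_of L \<Longrightarrow> a \<in> Q_of L" for j
  proof (induction j)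
    case (Suc j)
    have "real (Suc j) / N - 1 / N = real j / N" by (simp add: add_divide_distrib)
    then show ?case using Suc step[of "real (Suc j) / N"] N by auto
  qed simp
  moreover have "a + of_real (real k / N) \<in> Q_of L"
  proof -
    have "(of_real R - (- a)) + of_real (real k / N - R) \<in> Q_of L"
      using k N R by (intro D Dr) (auto simp: divide_simps)
    then show ?thesis by (simp add: algebra_simps)
  qed
  ultimately show ?thesis by blast
qed

lemma psd_nonneg_on_Q_characters:
  assumes lin: "linear L" and psd: "positive_semidefinite L" and C: "\<And>a. C_of L a < \<infinity>"
    and pos: "\<And>\<alpha>. \<alpha> \<in> Q_characters L \<Longrightarrow> 0 \<le> \<alpha> a"
  shows "0 \<le> L a"
proof -
  have "0 \<le> L a + e * L 1" if "e > 0" for e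
  proof -
    have "a + of_real e \<in> Q_of L"
    proof (rule positive_in_Q_of[OF lin psd C])
      fix \<alpha> assume \<alpha>: "\<alpha> \<in> Q_characters L"
      then have "\<alpha> \<in> characters" by (simp add: Q_characters_def)
      then show "0 < \<alpha> (a + of_real e)" using pos[OF \<alpha>] that by (simp add: characters_simps)
    qed
    from Q_ofD[OF this, of 1] show ?thesis
      using lin by (simp add: of_real_def linear_add linear_scale)
  qed
  then have "\<forall>\<^sub>F e in at_right 0. 0 \<le> L a + e * L 1"
    by (auto simp: eventually_at_right_less eventually_at_filter)
  moreover have "((\<lambda>e. L a + e * L 1) \<longlongrightarrow> L a + 0 * L 1) (at_right 0)"
    by (intro tendsto_intros)
  ultimately show ?thesis
    using tendsto_lowerbound[of _ _ "at_right (0::real)" 0] by simp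
qed

section \<open>The algebra as functions on a compact set of characters\<close>

text \<open>A copy of the space of functions \<open>'a \<Rightarrow> real\<close> with the topology of pointwise convergence, made an instance of
\<open>t2_space\<close>, the class in which the Stone--Weierstrass theorem is formulated.\<close>

typedef 'a real_fun = "UNIV :: ('a \<Rightarrow> real) set"
  morphisms apply_fun Real_Fun ..

instantiation real_fun :: (type) t2_space
begin

definition open_real_fun :: "'a real_fun set \<Rightarrow> bool" where
  "open_real_fun U \<longleftrightarrow> open (Real_Fun -` U)"

instance
proof
  show "open (UNIV :: 'a real_fun set)" by (simp add: open_real_fun_def)
  show "open (U \<inter> V)" if "open U" "open V" for U V :: "'a real_fun set"
    using that by (auto simp: open_real_fun_def vimage_Int intro: open_Int)
  show "open (\<Union>K)" if "\<forall>U\<in>K. open U" for K :: "'a real_fun set set"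
    using that by (auto simp: open_real_fun_def vimage_Union)
  fix f g :: "'a real_fun" assume "f \<noteq> g"
  then have "apply_fun f \<noteq> apply_fun g" by (simp add: apply_fun_inject)
  then obtain x where x: "apply_fun f x \<noteq> apply_fun g x" by auto
  obtain U V where UV: "open U" "open V" "apply_fun f x \<in> U" "apply_fun g x \<in> V" "U \<inter> V = {}"
    using hausdorff[OF x] by (elim exE conjE)
  have *: "open {h. apply_fun h x \<in> W}" if "open W" for W :: "real set"
    using product_topology_basis'[of "{x}" "\<lambda>_. W" "\<lambda>y. y"] that
    by (simp add: open_real_fun_def vimage_def Real_Fun_inverse)
  show "\<exists>U V. open U \<and> open V \<and> f \<in> U \<and> g \<in> V \<and> U \<inter> V = {}"
    using UV by (intro exI[of _ "{h. apply_fun h x \<in> U}"] exI[of _ "{h. apply_fun h x \<in> V}"])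
      (auto simp: *)
qed

end

lemma continuous_on_Real_Fun: "continuous_on (A :: ('a \<Rightarrow> real) set) Real_Fun"
proof -
  have "continuous_on (UNIV :: ('a \<Rightarrow> real) set) Real_Fun"
    by (simp add: continuous_on_open_vimage open_real_fun_def)
  then show ?thesis by (rule continuous_on_subset) simp
qed

lemma continuous_on_apply_fun: "continuous_on (A :: 'a real_fun set) apply_fun"
proof -
  have "Real_Fun -` apply_fun -` U = U" for U :: "('a \<Rightarrow> real) set"
    by (simp add: vimage_def Real_Fun_inverse)
  then have "continuous_on (UNIV :: 'a real_fun set) apply_fun"
    by (simp add: continuous_on_open_vimage open_real_fun_def)
  then show ?thesis by (rule continuous_on_subset) simp
qed

lemma compact_imp_closed_fun:
  fixes S :: "('a \<Rightarrow> real) set"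
  assumes "compact S"
  shows "closed S"
proof -
  have "closed (Real_Fun ` S)"
    by (intro compact_imp_closed compact_continuous_image continuous_on_Real_Fun assms)
  then have "closed (Real_Fun -` Real_Fun ` S)"
    by (intro closed_vimage continuous_on_Real_Fun)
  also have "Real_Fun -` Real_Fun ` S = S"
    by (auto simp: Real_Fun_inject)
  finally show ?thesis .
qed

lemma continuous_on_evaluation: "continuous_on A (\<lambda>\<alpha>. (\<alpha> :: 'a \<Rightarrow> real) a)"
  by (rule continuous_on_subset[OF continuous_on_product_coordinates]) simp

lemma closed_evaluation_ge: "closed {\<alpha> :: 'a \<Rightarrow> real. r \<le> \<alpha> a}"
  by (intro closed_Collect_le continuous_on_evaluation continuous_on_const)

lemma closed_evaluation_le: "closed {\<alpha> :: 'a \<Rightarrow> real. \<alpha> a \<le> r}"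
  by (intro closed_Collect_le continuous_on_evaluation continuous_on_const)

lemma evaluation_function_ring:
  assumes "compact S" "S \<subseteq> characters"
  shows "function_ring_on {g. \<exists>a. \<forall>x\<in>Real_Fun ` S. g x = apply_fun x a} (Real_Fun ` S)"
proof
  let ?R = "{g. \<exists>a. \<forall>x\<in>Real_Fun ` S. g x = apply_fun x a}"
  have ch: "apply_fun x \<in> characters" if "x \<in> Real_Fun ` S" for x
    using that assms(2) by (auto simp: Real_Fun_inverse)
  show "compact (Real_Fun ` S)"
    by (intro compact_continuous_image continuous_on_Real_Fun assms)
  show "continuous_on (Real_Fun ` S) g" if "g \<in> ?R" for g
  proof -
    obtain a where a: "\<forall>x\<in>Real_Fun ` S. g x = apply_fun x a" using \<open>g \<in> ?R\<close> by blast
    have "continuous_on (Real_Fun ` S) (\<lambda>x. apply_fun x a)"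
      by (rule continuous_on_product_then_coordinatewise[OF continuous_on_apply_fun])
    then show ?thesis
      using a by (subst continuous_on_cong[OF refl, of _ g "\<lambda>x. apply_fun x a"]) auto
  qed
  show "(\<lambda>x. g x + h x) \<in> ?R" "(\<lambda>x. g x * h x) \<in> ?R" if gh: "g \<in> ?R" "h \<in> ?R" for g h
  proof -
    obtain a b where ab: "\<forall>x\<in>Real_Fun ` S. g x = apply_fun x a" "\<forall>x\<in>Real_Fun ` S. h x = apply_fun x b"
      using gh by auto
    show "(\<lambda>x. g x + h x) \<in> ?R"
      using ab by (auto intro!: exI[of _ "a + b"] simp: characters_simps[OF ch])
    show "(\<lambda>x. g x * h x) \<in> ?R"
      using ab by (auto intro!: exI[of _ "a * b"] simp: characters_simps[OF ch])
  qed
  show "(\<lambda>_. c) \<in> ?R" for c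
    by (auto intro!: exI[of _ "of_real c"] simp: characters_simps[OF ch])
  show "\<exists>g\<in>?R. g x \<noteq> g y" if "x \<noteq> y" for x y
  proof -
    have "apply_fun x \<noteq> apply_fun y" using that by (simp add: apply_fun_inject)
    then obtain a where "apply_fun x a \<noteq> apply_fun y a" by auto
    then show ?thesis by (intro bexI[of _ "\<lambda>x. apply_fun x a"]) auto
  qed
qed

text \<open>The functions \<open>\<alpha> \<mapsto> \<alpha> a\<close> on a set of characters form an algebra with unit, and distinct characters differ at
some \<open>a\<close>, so the Stone--Weierstrass theorem applies.\<close>

lemma evaluations_dense:
  assumes S: "compact S" "S \<subseteq> characters" and f: "continuous_on S f" and e: "0 < e"
  obtains a where "\<And>\<alpha>. \<alpha> \<in> S \<Longrightarrow> \<bar>f \<alpha> - \<alpha> a\<bar> < e"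
proof -
  interpret function_ring_on "{g. \<exists>a. \<forall>x\<in>Real_Fun ` S. g x = apply_fun x a}" "Real_Fun ` S"
    by (rule evaluation_function_ring[OF S])
  have "continuous_on (Real_Fun ` S) (\<lambda>x. f (apply_fun x))"
    by (intro continuous_on_compose2[OF f continuous_on_apply_fun]) (auto simp: Real_Fun_inverse)
  from Stone_Weierstrass_basic[OF this e] that show ?thesis
    by (force simp: Real_Fun_inverse)
qed

text \<open>An approximate form of Urysohn's lemma in which the separating function comes from the algebra itself. Such an
\<open>h\<close> may multiply elements of the algebra, so functions can be cut off without leaving the domain
of \<open>L\<close>.\<close>

lemma evaluations_separate:
  assumes S: "compact S" "S \<subseteq> characters"
    and C: "closed C" "C \<subseteq> S" and D: "closed D" "D \<subseteq> S" and disj: "C \<inter> D = {}"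
    and e: "0 < e" "e < 1"
  obtains h where "\<And>\<alpha>. \<alpha> \<in> S \<Longrightarrow> 0 \<le> \<alpha> h \<and> \<alpha> h \<le> 1"
    "\<And>\<alpha>. \<alpha> \<in> C \<Longrightarrow> 1 - e < \<alpha> h" "\<And>\<alpha>. \<alpha> \<in> D \<Longrightarrow> \<alpha> h < e"
proof -
  interpret function_ring_on "{g. \<exists>a. \<forall>x\<in>Real_Fun ` S. g x = apply_fun x a}" "Real_Fun ` S"
    by (rule evaluation_function_ring[OF S])
  have im: "closed (Real_Fun ` K)" if K: "closed K" "K \<subseteq> S" for K
  proof -
    have "compact (S \<inter> K)" by (rule compact_Int_closed[OF S(1) K(1)])
    then have "compact K" using K(2) by (simp add: Int_absorb1)
    then show ?thesis by (intro compact_imp_closed compact_continuous_image continuous_on_Real_Fun)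
  qed
  have "Real_Fun ` D \<inter> Real_Fun ` C = {}" using disj by (auto simp: Real_Fun_inject)
  from two[OF im[OF D] _ im[OF C] _ this e] C D obtain g a
    where g: "\<forall>x\<in>Real_Fun ` S. g x = apply_fun x a" "g ` Real_Fun ` S \<subseteq> {0..1}"
      "\<forall>x\<in>Real_Fun ` D. g x < e" "\<forall>x\<in>Real_Fun ` C. g x > 1 - e"
    by (auto simp: image_mono)
  have "g (Real_Fun \<alpha>) = \<alpha> a" if "\<alpha> \<in> S" for \<alpha> using g(1) that by (simp add: Real_Fun_inverse)
  then show ?thesis using g(2-4) C D by (intro that[of a]) (force simp: image_subset_iff)+
qed

lemma closed_characters: "closed (characters :: ('a::{comm_ring_1,real_algebra_1} \<Rightarrow> real) set)"
proof -
  have "characters = (\<Inter>a b :: 'a. {\<alpha> :: 'a \<Rightarrow> real. \<alpha> (a + b) = \<alpha> a + \<alpha> b}) \<inter>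
    (\<Inter>r. \<Inter>a :: 'a. {\<alpha>. \<alpha> (r *\<^sub>R a) = r * \<alpha> a}) \<inter>
    (\<Inter>a b. {\<alpha>. \<alpha> (a * b) = \<alpha> a * \<alpha> b}) \<inter> {\<alpha>. \<alpha> 1 = 1}"
    by (auto simp: characters_simps) (auto simp: characters_def intro!: linearI)
  moreover have "closed \<dots>"
    by (intro closed_Int closed_INT ballI closed_Collect_eq continuous_intros continuous_on_evaluation)
  ultimately show ?thesis by simp
qed

text \<open>A closed subset of the product of the intervals \<open>[-C_of L a, C_of L a]\<close>, which is compact by Tychonoff's
theorem.\<close>

lemma compact_Q_characters:
  assumes "linear L" "positive_semidefinite L" "\<And>a. C_of L a < \<infinity>"
  shows "compact (Q_characters L)"
proof -
  let ?B = "Pi\<^sub>E UNIV (\<lambda>a. cball (0 :: real) (real_of_ereal (C_of L a)))"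
  have "compact ?B"
    using compactin_PiE[of "\<lambda>_. euclidean" UNIV "\<lambda>a. cball (0::real) (real_of_ereal (C_of L a))"]
    by (simp add: euclidean_product_topology)
  moreover have "closed (Q_characters L)"
  proof -
    have "Q_characters L = characters \<inter> (\<Inter>q\<in>Q_of L. {\<alpha>. 0 \<le> \<alpha> q})"
      by (auto simp: Q_characters_def)
    also have "closed \<dots>"
      by (intro closed_Int closed_characters closed_INT ballI closed_evaluation_ge)
    finally show ?thesis .
  qed
  ultimately have "compact (?B \<inter> Q_characters L)" by (rule compact_Int_closed)
  moreover have "Q_characters L \<subseteq> ?B"
  proof
    fix \<alpha> assume \<alpha>: "\<alpha> \<in> Q_characters L"
    have "\<bar>\<alpha> a\<bar> \<le> real_of_ereal (C_of L a)" for a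
    proof -
      obtain c where "C_of L a = ereal c" "0 \<le> c" by (rule C_of_finiteE[OF assms(2,3)])
      then show ?thesis using Q_characters_bound[OF assms \<alpha>, of a] by simp
    qed
    then show "\<alpha> \<in> ?B" by auto
  qed
  ultimately show ?thesis by (simp add: Int_absorb1)
qed

section \<open>A content on the closed sets of characters\<close>

text \<open>The content \<open>\<lambda>(C) = inf {\<Lambda>(f) | f \<ge> 1\<^sub>C}\<close> of the Riesz--Markov--Kakutani theorem, with \<open>f\<close> restricted to the functions
\<open>\<alpha> \<mapsto> \<alpha> a\<close> on \<open>S\<close>. Taking \<open>S\<close> and \<open>L\<close> as arguments allows a comparison between an arbitrary representing measure
and this content.\<close>

definition upper_content ::
  "('a::{comm_ring_1,real_algebra_1} \<Rightarrow> real) set \<Rightarrow> ('a \<Rightarrow> real) \<Rightarrow> ('a \<Rightarrow> real) set \<Rightarrow> real"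
  where "upper_content S L C = Inf {L a | a. (\<forall>\<alpha>\<in>S. 0 \<le> \<alpha> a) \<and> (\<forall>\<alpha>\<in>C. 1 \<le> \<alpha> a)}"

lemma le_if_le_small_multiples:
  fixes x y K :: real
  assumes "\<And>e. 0 < e \<Longrightarrow> e < 1 \<Longrightarrow> x \<le> y + e * K"
  shows "x \<le> y"
proof (rule tendsto_lowerbound)
  show "((\<lambda>e. y + e * K) \<longlongrightarrow> y) (at_right 0)"
    by (rule tendsto_eq_intros refl | simp)+
  have "\<forall>\<^sub>F e::real in at_right 0. 0 < e \<and> e < 1"
    using eventually_at_right_real[of 0 "1::real"] by (simp add: greaterThanLessThan_def)
  then show "\<forall>\<^sub>F e in at_right 0. x \<le> y + e * K"
    by eventually_elim (use assms in blast)
qed simp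

text \<open>Positivity is required only for elements that are nonnegative on \<open>S\<close>. It follows that \<open>L a\<close> depends only on the
values \<open>\<alpha> a\<close> for \<open>\<alpha> \<in> S\<close>, so \<open>L\<close> is a positive functional on a dense space of continuous functions
on \<open>S\<close>.\<close>

locale positive_on_characters =
  fixes S :: "('a::{comm_ring_1,real_algebra_1} \<Rightarrow> real) set" and L :: "'a \<Rightarrow> real"
  assumes compact_S: "compact S" and S_characters: "S \<subseteq> characters"
    and linear_L: "linear L"
    and L_nonneg: "\<And>a. (\<And>\<alpha>. \<alpha> \<in> S \<Longrightarrow> 0 \<le> \<alpha> a) \<Longrightarrow> 0 \<le> L a"
begin

lemma S_simps:
  assumes "\<alpha> \<in> S"
  shows "\<alpha> (a + b) = \<alpha> a + \<alpha> b" "\<alpha> (a - b) = \<alpha> a - \<alpha> b" "\<alpha> (- a) = - \<alpha> a"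
    "\<alpha> (a * b) = \<alpha> a * \<alpha> b" "\<alpha> 1 = 1" "\<alpha> 0 = 0" "\<alpha> (r *\<^sub>R a) = r * \<alpha> a"
    "\<alpha> (of_real r) = r"
  using assms S_characters by (simp_all add: characters_simps subset_iff)

lemma S_sum: "\<alpha> \<in> S \<Longrightarrow> \<alpha> (\<Sum>i\<in>I. f i) = (\<Sum>i\<in>I. \<alpha> (f i))"
  using S_characters by (intro linear_sum characters_linear) auto

lemmas L_simps = linear_add[OF linear_L] linear_diff[OF linear_L] linear_neg[OF linear_L]
  linear_0[OF linear_L] linear_scale[OF linear_L]

lemma L_mono: "(\<And>\<alpha>. \<alpha> \<in> S \<Longrightarrow> \<alpha> a \<le> \<alpha> b) \<Longrightarrow> L a \<le> L b"
  using L_nonneg[of "b - a"] by (simp add: S_simps L_simps)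

lemma L_of_real: "L (of_real r) = r * L 1"
  by (simp add: of_real_def L_simps)

lemma L_1_nonneg: "0 \<le> L 1"
  by (rule L_nonneg) (simp add: S_simps)

lemma closed_S: "closed S"
  by (rule compact_imp_closed_fun[OF compact_S])

lemma content_le:
  assumes "\<And>\<alpha>. \<alpha> \<in> S \<Longrightarrow> 0 \<le> \<alpha> a" "\<And>\<alpha>. \<alpha> \<in> C \<Longrightarrow> 1 \<le> \<alpha> a"
  shows "upper_content S L C \<le> L a"
  unfolding upper_content_def
proof (rule cInf_lower)
  show "bdd_below {L a |a. (\<forall>\<alpha>\<in>S. 0 \<le> \<alpha> a) \<and> (\<forall>\<alpha>\<in>C. 1 \<le> \<alpha> a)}"
    using L_nonneg by (auto intro!: bdd_belowI[of _ 0])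
qed (use assms in blast)

lemma content_le_scaled:
  assumes C: "C \<subseteq> S" and r: "0 < r"
    and a: "\<And>\<alpha>. \<alpha> \<in> S \<Longrightarrow> 0 \<le> \<alpha> a" "\<And>\<alpha>. \<alpha> \<in> C \<Longrightarrow> r \<le> \<alpha> a"
  shows "r * upper_content S L C \<le> L a"
proof -
  have "upper_content S L C \<le> L ((1 / r) *\<^sub>R a)"
  proof (rule content_le)
    show "0 \<le> \<alpha> ((1 / r) *\<^sub>R a)" if "\<alpha> \<in> S" for \<alpha> using a(1) r that by (simp add: S_simps)
    show "1 \<le> \<alpha> ((1 / r) *\<^sub>R a)" if "\<alpha> \<in> C" for \<alpha>
      using a(2)[OF that] r that C by (simp add: S_simps subset_iff)
  qed
  then show ?thesis using r by (simp add: L_simps field_simps)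
qed

lemma content_set_nonempty:
  assumes "C \<subseteq> S"
  shows "{L a | a. (\<forall>\<alpha>\<in>S. 0 \<le> \<alpha> a) \<and> (\<forall>\<alpha>\<in>C. 1 \<le> \<alpha> a)} \<noteq> {}"
proof -
  have "(\<forall>\<alpha>\<in>S. 0 \<le> \<alpha> 1) \<and> (\<forall>\<alpha>\<in>C. 1 \<le> \<alpha> 1)" using assms by (auto simp: S_simps)
  then show ?thesis by blast
qed

lemma content_nonneg:
  assumes "C \<subseteq> S"
  shows "0 \<le> upper_content S L C"
  unfolding upper_content_def
  by (rule cInf_greatest[OF content_set_nonempty[OF assms]]) (use L_nonneg in auto)

lemma content_approx:
  assumes "C \<subseteq> S" "0 < e"
  obtains a where "\<And>\<alpha>. \<alpha> \<in> S \<Longrightarrow> 0 \<le> \<alpha> a" "\<And>\<alpha>. \<alpha> \<in> C \<Longrightarrow> 1 \<le> \<alpha> a" "L a < upper_content S L C + e"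
proof -
  have "Inf {L a | a. (\<forall>\<alpha>\<in>S. 0 \<le> \<alpha> a) \<and> (\<forall>\<alpha>\<in>C. 1 \<le> \<alpha> a)} < upper_content S L C + e"
    using assms(2) by (simp add: upper_content_def)
  from cInf_lessD[OF content_set_nonempty[OF assms(1)] this] show ?thesis using that by blast
qed

lemma content_empty: "upper_content S L {} = 0"
  using content_le[of 0 "{}"] content_nonneg[of "{}"] by (simp add: S_simps L_simps)

lemma content_le_L_1:
  assumes "C \<subseteq> S"
  shows "upper_content S L C \<le> L 1"
  using assms by (intro content_le) (auto simp: S_simps)

lemma content_S: "upper_content S L S = L 1"
proof (rule antisym)
  show "L 1 \<le> upper_content S L S"
  proof (rule field_le_epsilon)
    fix e :: real assume "0 < e"
    then obtain a where a: "\<And>\<alpha>. \<alpha> \<in> S \<Longrightarrow> 1 \<le> \<alpha> a" "L a < upper_content S L S + e"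
      by (rule content_approx[OF order_refl]) blast
    have "L 1 \<le> L a" using a(1) by (intro L_mono) (simp add: S_simps)
    then show "L 1 \<le> upper_content S L S + e" using a(2) by simp
  qed
qed (simp add: content_le_L_1)

lemma content_Un_le:
  assumes CD: "C \<subseteq> S" "D \<subseteq> S"
  shows "upper_content S L (C \<union> D) \<le> upper_content S L C + upper_content S L D"
proof (rule field_le_epsilon)
  fix e :: real assume "0 < e"
  then have e: "0 < e / 2" by simp
  obtain a where a: "\<And>\<alpha>. \<alpha> \<in> S \<Longrightarrow> 0 \<le> \<alpha> a" "\<And>\<alpha>. \<alpha> \<in> C \<Longrightarrow> 1 \<le> \<alpha> a"
    "L a < upper_content S L C + e / 2"
    using content_approx[OF CD(1) e] by blast
  obtain b where b: "\<And>\<alpha>. \<alpha> \<in> S \<Longrightarrow> 0 \<le> \<alpha> b" "\<And>\<alpha>. \<alpha> \<in> D \<Longrightarrow> 1 \<le> \<alpha> b"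
    "L b < upper_content S L D + e / 2"
    using content_approx[OF CD(2) e] by blast
  have "upper_content S L (C \<union> D) \<le> L (a + b)"
  proof (rule content_le)
    show "0 \<le> \<alpha> (a + b)" if "\<alpha> \<in> S" for \<alpha> using that a b by (simp add: S_simps)
    show "1 \<le> \<alpha> (a + b)" if "\<alpha> \<in> C \<union> D" for \<alpha>
    proof -
      have "\<alpha> \<in> S" using that CD by auto
      then show ?thesis using that a(1,2)[of \<alpha>] b(1,2)[of \<alpha>] by (auto simp: S_simps)
    qed
  qed
  then show "upper_content S L (C \<union> D) \<le> upper_content S L C + upper_content S L D + e"
    using a(3) b(3) by (simp add: L_simps)
qed

text \<open>If \<open>a \<ge> 1\<close> on \<open>C \<union> D\<close> and \<open>h\<close> is close to \<open>1\<close> on \<open>C\<close> and to \<open>0\<close> on \<open>D\<close>, then \<open>a * h\<close> and \<open>a * (1 - h)\<close> are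
almost admissible for \<open>C\<close> and \<open>D\<close>, and their sum is \<open>a\<close>.\<close>

lemma content_disjoint:
  assumes C: "closed C" "C \<subseteq> S" and D: "closed D" "D \<subseteq> S" and disj: "C \<inter> D = {}"
  shows "upper_content S L C + upper_content S L D \<le> upper_content S L (C \<union> D)"
proof (rule le_if_le_small_multiples)
  fix e :: real assume e: "0 < e" "e < 1"
  obtain a where a: "\<And>\<alpha>. \<alpha> \<in> S \<Longrightarrow> 0 \<le> \<alpha> a" "\<And>\<alpha>. \<alpha> \<in> C \<union> D \<Longrightarrow> 1 \<le> \<alpha> a"
    "L a < upper_content S L (C \<union> D) + e"
    using content_approx[of "C \<union> D" e] C D e by blast
  obtain h where h: "\<And>\<alpha>. \<alpha> \<in> S \<Longrightarrow> 0 \<le> \<alpha> h \<and> \<alpha> h \<le> 1"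
    "\<And>\<alpha>. \<alpha> \<in> C \<Longrightarrow> 1 - e < \<alpha> h" "\<And>\<alpha>. \<alpha> \<in> D \<Longrightarrow> \<alpha> h < e"
    using evaluations_separate[OF compact_S S_characters C D disj e] by blast
  have prod: "1 - e \<le> x * y" if "1 \<le> x" "1 - e < y" for x y :: real
    using mult_mono[of 1 x "1 - e" y] that e by simp
  have "(1 - e) * upper_content S L C \<le> L (a * h)"
  proof (rule content_le_scaled)
    show "0 \<le> \<alpha> (a * h)" if "\<alpha> \<in> S" for \<alpha> using a(1) h(1) that by (simp add: S_simps)
    show "1 - e \<le> \<alpha> (a * h)" if "\<alpha> \<in> C" for \<alpha>
      using that C prod a(2)[of \<alpha>] h(2)[of \<alpha>] by (simp add: S_simps subset_iff)
  qed (use C e in auto)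
  moreover have "(1 - e) * upper_content S L D \<le> L (a * (1 - h))"
  proof (rule content_le_scaled)
    show "0 \<le> \<alpha> (a * (1 - h))" if "\<alpha> \<in> S" for \<alpha> using a(1) h(1) that by (simp add: S_simps)
    show "1 - e \<le> \<alpha> (a * (1 - h))" if "\<alpha> \<in> D" for \<alpha>
      using that D prod[of "\<alpha> a" "1 - \<alpha> h"] a(2)[of \<alpha>] h(3)[of \<alpha>] by (simp add: S_simps subset_iff)
  qed (use D e in auto)
  moreover have "L (a * h) + L (a * (1 - h)) = L a"
    by (simp add: algebra_simps flip: L_simps)
  ultimately show "upper_content S L C + upper_content S L D
      \<le> upper_content S L (C \<union> D) + e * (1 + upper_content S L C + upper_content S L D)"
    using a(3) by (simp add: algebra_simps)
qed

text \<open>If \<open>a\<close> is almost optimal for \<open>C\<close>, then it is almost admissible on the open neighbourhood of \<open>C\<close> where \<open>a > 1 - d\<close>.\<close>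

lemma content_outer_open:
  assumes C: "C \<subseteq> S" and e: "0 < e"
  obtains U where "open U" "C \<subseteq> U" "\<And>D. D \<subseteq> U \<inter> S \<Longrightarrow> upper_content S L D \<le> upper_content S L C + e"
proof -
  \<comment> \<open>The error is \<open>d\<close> from the choice of \<open>a\<close> plus \<open>d * L 1\<close> from replacing \<open>1\<close> by \<open>1 - d\<close>.\<close>
  define d where "d = min (1 / 2) (e / (1 + L 1))"
  have d: "0 < d" "d < 1" using e L_1_nonneg by (auto simp: d_def)
  have "d \<le> e / (1 + L 1)" by (simp add: d_def)
  then have d_le: "d * (1 + L 1) \<le> e" using L_1_nonneg by (simp add: pos_le_divide_eq)
  obtain a where a: "\<And>\<alpha>. \<alpha> \<in> S \<Longrightarrow> 0 \<le> \<alpha> a" "\<And>\<alpha>. \<alpha> \<in> C \<Longrightarrow> 1 \<le> \<alpha> a"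
    "L a < upper_content S L C + d"
    using content_approx[OF C d(1)] by blast
  show ?thesis
  proof
    show "open {\<alpha>. 1 - d < \<alpha> a}"
      by (intro open_Collect_less continuous_on_evaluation continuous_on_const)
    show "C \<subseteq> {\<alpha>. 1 - d < \<alpha> a}" using a(2) d by force
    fix D assume D: "D \<subseteq> {\<alpha>. 1 - d < \<alpha> a} \<inter> S"
    then have "(1 - d) * upper_content S L D \<le> L a"
      using a(1) d by (intro content_le_scaled) (auto simp: less_imp_le)
    moreover have "d * upper_content S L D \<le> d * L 1"
      using D d by (intro mult_left_mono content_le_L_1) auto
    ultimately have "upper_content S L D \<le> upper_content S L C + d * (1 + L 1)"
      using a(3) by (simp add: algebra_simps)
    then show "upper_content S L D \<le> upper_content S L C + e" using d_le by simp
  qed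
qed

section \<open>The Radon measure extending the content\<close>

text \<open>These are the two steps from the content to the outer measure: open sets are measured from inside by closed
subsets of \<open>S\<close>, and arbitrary sets from outside by open sets. All open sets of the ambient function space are
admitted, but only their trace on \<open>S\<close> counts, so the resulting measure lives on the whole space and is
concentrated on \<open>S\<close>.\<close>

definition inner_content :: "('a \<Rightarrow> real) set \<Rightarrow> ennreal" where
  "inner_content U = (SUP C\<in>{C. closed C \<and> C \<subseteq> U \<inter> S}. ennreal (upper_content S L C))"

definition outer_content :: "('a \<Rightarrow> real) set \<Rightarrow> ennreal" where
  "outer_content E = (INF U\<in>{U. open U \<and> E \<subseteq> U}. inner_content U)"

lemma content_le_inner: "closed C \<Longrightarrow> C \<subseteq> U \<inter> S \<Longrightarrow> ennreal (upper_content S L C) \<le> inner_content U"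
  unfolding inner_content_def by (intro SUP_upper) auto

lemma inner_leI:
  "(\<And>C. closed C \<Longrightarrow> C \<subseteq> U \<Longrightarrow> C \<subseteq> S \<Longrightarrow> ennreal (upper_content S L C) \<le> x) \<Longrightarrow> inner_content U \<le> x"
  unfolding inner_content_def by (intro SUP_least) auto

lemma inner_mono: "U \<subseteq> V \<Longrightarrow> inner_content U \<le> inner_content V"
  by (rule inner_leI) (rule content_le_inner, auto)

lemma inner_le_L_1: "inner_content U \<le> ennreal (L 1)"
  by (rule inner_leI) (intro ennreal_leI content_le_L_1)

lemma inner_disjoint_S:
  assumes "U \<inter> S = {}"
  shows "inner_content U = 0"
proof -
  have "inner_content U \<le> 0"
  proof (rule inner_leI)
    fix C assume "C \<subseteq> U" "C \<subseteq> S"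
    then have "C = {}" using assms by auto
    then show "ennreal (upper_content S L C) \<le> 0" by (simp add: content_empty)
  qed
  then show ?thesis by simp
qed

lemma outer_le_inner: "open U \<Longrightarrow> E \<subseteq> U \<Longrightarrow> outer_content E \<le> inner_content U"
  unfolding outer_content_def by (intro INF_lower) auto

lemma outer_geI: "(\<And>U. open U \<Longrightarrow> E \<subseteq> U \<Longrightarrow> x \<le> inner_content U) \<Longrightarrow> x \<le> outer_content E"
  unfolding outer_content_def by (intro INF_greatest) auto

lemma outer_open:
  assumes "open U"
  shows "outer_content U = inner_content U"
  using assms by (intro antisym outer_le_inner outer_geI inner_mono) auto

lemma outer_mono: "E \<subseteq> F \<Longrightarrow> outer_content E \<le> outer_content F"
  by (rule outer_geI) (rule outer_le_inner, auto)

lemma outer_le_L_1: "outer_content E \<le> ennreal (L 1)"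
  using outer_le_inner[of UNIV E] inner_le_L_1[of UNIV] by simp

lemma outer_closed:
  assumes C: "closed C" "C \<subseteq> S"
  shows "outer_content C = ennreal (upper_content S L C)"
proof (rule antisym)
  show "ennreal (upper_content S L C) \<le> outer_content C"
    using C by (intro outer_geI content_le_inner) auto
  show "outer_content C \<le> ennreal (upper_content S L C)"
  proof (rule ennreal_le_epsilon)
    fix e :: real assume e: "0 < e"
    obtain U where U: "open U" "C \<subseteq> U" "\<And>D. D \<subseteq> U \<inter> S \<Longrightarrow> upper_content S L D \<le> upper_content S L C + e"
      by (rule content_outer_open[OF C(2) e]) blast
    have "outer_content C \<le> inner_content U" using U by (intro outer_le_inner) auto
    also have "\<dots> \<le> ennreal (upper_content S L C + e)"
      using U(3) by (intro inner_leI ennreal_leI) auto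
    finally show "outer_content C \<le> ennreal (upper_content S L C) + ennreal e"
      using content_nonneg[OF C(2)] e by simp
  qed
qed

text \<open>A closed \<open>C \<subseteq> U \<union> V\<close> is cut into two closed pieces, one in \<open>U\<close> and one in \<open>V\<close>, along the level \<open>1 / 2\<close> of a function
that separates \<open>C - V\<close> from \<open>C - U\<close>.\<close>

lemma inner_Un:
  assumes UV: "open U" "open V"
  shows "inner_content (U \<union> V) \<le> inner_content U + inner_content V"
proof (rule inner_leI)
  fix C assume C: "closed C" "C \<subseteq> U \<union> V" "C \<subseteq> S"
  have half: "0 < (1 / 2 :: real)" "(1 / 2 :: real) < 1" by simp_all
  have "C - V \<subseteq> S" "C - U \<subseteq> S" "(C - V) \<inter> (C - U) = {}" using C by auto
  then obtain h where h: "\<And>\<alpha>. \<alpha> \<in> C - V \<Longrightarrow> 1 - 1 / 2 < \<alpha> h" "\<And>\<alpha>. \<alpha> \<in> C - U \<Longrightarrow> \<alpha> h < 1 / 2"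
    by (rule evaluations_separate[OF compact_S S_characters closed_Diff[OF C(1) UV(2)] _
        closed_Diff[OF C(1) UV(1)] _ _ half]) blast
  let ?C = "C \<inter> {\<alpha>. 1 / 2 \<le> \<alpha> h}" and ?D = "C \<inter> {\<alpha>. \<alpha> h \<le> 1 / 2}"
  have eq: "C = ?C \<union> ?D" by auto
  have "?C \<subseteq> U" using h(2) by force
  moreover have "?D \<subseteq> V" using h(1) by force
  ultimately have "ennreal (upper_content S L ?C) \<le> inner_content U" "ennreal (upper_content S L ?D) \<le> inner_content V"
    using C by (intro content_le_inner closed_Int closed_evaluation_ge closed_evaluation_le; auto)+
  then have sum: "ennreal (upper_content S L ?C) + ennreal (upper_content S L ?D) \<le> inner_content U + inner_content V"
    by (rule add_mono)
  have "upper_content S L C \<le> upper_content S L ?C + upper_content S L ?D"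
    using C(3) content_Un_le[of ?C ?D] eq by auto
  then have "ennreal (upper_content S L C) \<le> ennreal (upper_content S L ?C + upper_content S L ?D)" by (rule ennreal_leI)
  also have "\<dots> = ennreal (upper_content S L ?C) + ennreal (upper_content S L ?D)"
    using C(3) by (intro ennreal_plus content_nonneg) auto
  finally show "ennreal (upper_content S L C) \<le> inner_content U + inner_content V" using sum by (rule order_trans)
qed

lemma inner_finite_UN:
  fixes U :: "nat \<Rightarrow> _"
  assumes "\<And>i. open (U i)"
  shows "inner_content (\<Union>i<n. U i) \<le> (\<Sum>i<n. inner_content (U i))"
proof (induction n)
  case (Suc n)
  have "inner_content (\<Union>i<Suc n. U i) \<le> inner_content (\<Union>i<n. U i) + inner_content (U n)"
  proof -
    have "inner_content ((\<Union>i<n. U i) \<union> U n) \<le> inner_content (\<Union>i<n. U i) + inner_content (U n)"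
      using assms by (intro inner_Un open_UN) auto
    then show ?thesis by (simp add: lessThan_Suc Un_commute)
  qed
  also have "\<dots> \<le> (\<Sum>i<Suc n. inner_content (U i))" using Suc by (simp add: add_right_mono)
  finally show ?case .
qed (simp add: inner_disjoint_S)

text \<open>Compactness of the closed subsets of \<open>S\<close> reduces a countable union of open sets to a finite one.\<close>

lemma inner_UN:
  fixes U :: "nat \<Rightarrow> _"
  assumes "\<And>i. open (U i)"
  shows "inner_content (\<Union>i. U i) \<le> (\<Sum>i. inner_content (U i))"
proof (rule inner_leI)
  fix C assume C: "closed C" "C \<subseteq> (\<Union>i. U i)" "C \<subseteq> S"
  have "compact C" using compact_Int_closed[OF compact_S C(1)] C(3) by (simp add: Int_absorb1)
  from compactE_image[OF this _ C(2)] assms obtain F where F: "finite F" "C \<subseteq> (\<Union>i\<in>F. U i)"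
    by auto
  obtain n where "F \<subseteq> {..<n}" using F(1) finite_nat_iff_bounded by auto
  then have "C \<subseteq> (\<Union>i<n. U i)" using F(2) by blast
  then have "ennreal (upper_content S L C) \<le> inner_content (\<Union>i<n. U i)" using C by (intro content_le_inner) auto
  also have "\<dots> \<le> (\<Sum>i<n. inner_content (U i))" by (rule inner_finite_UN[OF assms])
  also have "\<dots> \<le> (\<Sum>i. inner_content (U i))" by (intro sum_le_suminf summableI) auto
  finally show "ennreal (upper_content S L C) \<le> (\<Sum>i. inner_content (U i))" .
qed

lemma outer_UN:
  fixes A :: "nat \<Rightarrow> _"
  shows "outer_content (\<Union>i. A i) \<le> (\<Sum>i. outer_content (A i))"
proof (rule ennreal_le_epsilon)
  fix e :: real assume e: "0 < e"
  have "\<exists>U. open U \<and> A n \<subseteq> U \<and> inner_content U \<le> outer_content (A n) + e * (1/2) ^ Suc n" for n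
  proof -
    have "outer_content (A n) < top" by (rule le_less_trans[OF outer_le_L_1 ennreal_less_top])
    then have "outer_content (A n) < outer_content (A n) + ennreal (e * (1/2) ^ Suc n)"
      using e by (auto simp: less_top)
    then have "\<exists>U\<in>{U. open U \<and> A n \<subseteq> U}. inner_content U < outer_content (A n) + ennreal (e * (1/2) ^ Suc n)"
      unfolding outer_content_def[of "A n"] by (simp only: INF_less_iff)
    then show ?thesis by (auto intro: less_imp_le)
  qed
  then obtain U where U: "\<And>n. open (U n)" "\<And>n. A n \<subseteq> U n"
    "\<And>n. inner_content (U n) \<le> outer_content (A n) + e * (1/2) ^ Suc n"
    by metis
  have "outer_content (\<Union>i. A i) \<le> inner_content (\<Union>i. U i)" using U by (intro outer_le_inner) auto
  also have "\<dots> \<le> (\<Sum>i. inner_content (U i))" by (rule inner_UN[OF U(1)])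
  also have "\<dots> \<le> (\<Sum>n. outer_content (A n) + e * (1/2) ^ Suc n)"
    by (intro suminf_le allI U(3)) auto
  also have "\<dots> = (\<Sum>n. outer_content (A n)) + (\<Sum>n. ennreal e * ennreal ((1/2) ^ Suc n))"
    using e by (subst suminf_add[symmetric])
      (auto simp del: ennreal_suminf_cmult simp add: ennreal_mult[symmetric])
  also have "\<dots> = (\<Sum>n. outer_content (A n)) + e"
    unfolding ennreal_suminf_cmult
    by (subst suminf_ennreal_eq[OF zero_le_power power_half_series]) auto
  finally show "outer_content (\<Union>i. A i) \<le> (\<Sum>i. outer_content (A i)) + ennreal e" .
qed

lemma outer_measure_space_outer: "outer_measure_space UNIV outer_content"
  unfolding outer_measure_space_def positive_def increasing_def countably_subadditive_def
  using outer_open[of "{}"] outer_mono outer_UN by (simp add: inner_disjoint_S)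

text \<open>Exhaust \<open>U - F\<close> by a closed set \<open>D\<close> and then \<open>U - D\<close>, which is open and contains \<open>F \<inter> U\<close>, by a closed set \<open>C\<close>. These two
are disjoint subsets of \<open>U\<close>, on which the content is additive.\<close>

lemma inner_split_closed:
  assumes F: "closed F" and U: "open U"
  shows "outer_content (F \<inter> U) + inner_content (U - F) \<le> inner_content U"
proof -
  have content: "outer_content (F \<inter> U) + ennreal (upper_content S L D) \<le> inner_content U"
    if D: "closed D" "D \<subseteq> (U - F) \<inter> S" for D
  proof -
    have "outer_content (F \<inter> U) + ennreal (upper_content S L D) \<le> inner_content (U - D) + ennreal (upper_content S L D)"
      using D U by (intro add_right_mono outer_le_inner) auto
    also have "\<dots> = (SUP C\<in>{C. closed C \<and> C \<subseteq> (U - D) \<inter> S}. ennreal (upper_content S L C) + ennreal (upper_content S L D))"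
      unfolding inner_content_def by (intro ennreal_SUP_add_left[symmetric]) (auto intro!: exI[of _ "{}"])
    also have "\<dots> \<le> inner_content U"
    proof (rule SUP_least)
      fix C assume "C \<in> {C. closed C \<and> C \<subseteq> (U - D) \<inter> S}"
      then have C: "closed C" "C \<subseteq> S" "C \<subseteq> U" "C \<inter> D = {}" by auto
      have "ennreal (upper_content S L C) + ennreal (upper_content S L D) = ennreal (upper_content S L C + upper_content S L D)"
        using C D by (intro ennreal_plus[symmetric] content_nonneg) auto
      also have "\<dots> \<le> ennreal (upper_content S L (C \<union> D))"
        using C D by (intro ennreal_leI content_disjoint) auto
      also have "\<dots> \<le> inner_content U" using C D by (intro content_le_inner) auto
      finally show "ennreal (upper_content S L C) + ennreal (upper_content S L D) \<le> inner_content U" .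
    qed
    finally show ?thesis .
  qed
  have "outer_content (F \<inter> U) + inner_content (U - F)
      = (SUP D\<in>{D. closed D \<and> D \<subseteq> (U - F) \<inter> S}. outer_content (F \<inter> U) + ennreal (upper_content S L D))"
    unfolding inner_content_def by (intro ennreal_SUP_add_right) (auto intro!: exI[of _ "{}"])
  also have "\<dots> \<le> inner_content U" using content by (intro SUP_least) auto
  finally show ?thesis .
qed

lemma closed_in_lambda_system:
  assumes F: "closed F"
  shows "F \<in> lambda_system UNIV UNIV outer_content"
proof -
  have "outer_content (F \<inter> E) + outer_content (- F \<inter> E) = outer_content E" for E
  proof (rule antisym)
    show "outer_content (F \<inter> E) + outer_content (- F \<inter> E) \<le> outer_content E"
    proof (rule outer_geI)
      fix U assume U: "open U" "E \<subseteq> U"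
      have "outer_content (F \<inter> E) + outer_content (- F \<inter> E) \<le> outer_content (F \<inter> U) + inner_content (U - F)"
        using U F by (intro add_mono outer_mono outer_le_inner) (auto simp: open_Diff)
      also have "\<dots> \<le> inner_content U" by (rule inner_split_closed[OF F U(1)])
      finally show "outer_content (F \<inter> E) + outer_content (- F \<inter> E) \<le> inner_content U" .
    qed
    have "subadditive UNIV outer_content"
      using outer_measure_space_outer ring_of_sets.countably_subadditive_subadditive[of UNIV UNIV outer_content]
        sigma_algebra_Pow[of "UNIV :: ('a \<Rightarrow> real) set"]
      by (auto simp: outer_measure_space_def sigma_algebra_def algebra_def)
    from subadditiveD[OF this, of "F \<inter> E" "- F \<inter> E"]
    have "outer_content (F \<inter> E \<union> - F \<inter> E) \<le> outer_content (F \<inter> E) + outer_content (- F \<inter> E)" by blast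
    also have "F \<inter> E \<union> - F \<inter> E = E" by blast
    finally show "outer_content E \<le> outer_content (F \<inter> E) + outer_content (- F \<inter> E)" .
  qed
  then show ?thesis by (simp add: lambda_system_def Compl_eq_Diff_UNIV)
qed

definition riesz_measure :: "('a \<Rightarrow> real) measure" where
  "riesz_measure = measure_of UNIV (sets borel) outer_content"

lemma sets_riesz_measure [simp, measurable_cong]: "sets riesz_measure = sets borel"
  unfolding riesz_measure_def using sets.sigma_sets_eq[of "borel :: ('a \<Rightarrow> real) measure"]
  by (subst sets_measure_of) auto

lemma space_riesz_measure [simp]: "space riesz_measure = UNIV"
  using sets_eq_imp_space_eq[OF sets_riesz_measure] by simp

lemma emeasure_riesz_measure:
  assumes "B \<in> sets borel"
  shows "emeasure riesz_measure B = outer_content B"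
proof -
  interpret U: sigma_algebra UNIV "UNIV :: ('a \<Rightarrow> real) set set" using sigma_algebra_Pow[of UNIV] by simp
  have L: "measure_space UNIV (lambda_system UNIV UNIV outer_content) outer_content"
    by (rule U.caratheodory_lemma[OF outer_measure_space_outer])
  then interpret L: sigma_algebra UNIV "lambda_system UNIV UNIV outer_content"
    by (simp add: measure_space_def)
  have borel_le: "sets borel \<subseteq> lambda_system UNIV UNIV outer_content"
    unfolding borel_eq_closed sets_measure_of[OF subset_UNIV[THEN PowI, THEN subsetI, of "Collect closed"]]
    by (intro L.sigma_sets_subset) (auto intro: closed_in_lambda_system)
  have "measure_space UNIV (sets borel) outer_content"
    using measure_down[OF L _ borel_le] sets.sigma_algebra_axioms[of borel] by simp
  then show ?thesis
    unfolding riesz_measure_def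
    using assms by (intro emeasure_measure_of_sigma) (auto simp: measure_space_def)
qed

lemma emeasure_riesz_measure_closed:
  assumes "closed C" "C \<subseteq> S"
  shows "emeasure riesz_measure C = ennreal (upper_content S L C)"
  using assms by (simp add: emeasure_riesz_measure outer_closed)

lemma emeasure_riesz_measure_Compl_S: "emeasure riesz_measure (- S) = 0"
  using closed_S by (simp add: emeasure_riesz_measure outer_open inner_disjoint_S open_Compl)

lemma AE_riesz_measure: "AE \<alpha> in riesz_measure. \<alpha> \<in> S"
  using closed_S emeasure_riesz_measure_Compl_S by (intro AE_I[where N = "- S"]) auto

lemma finite_riesz_measure: "finite_measure riesz_measure"
  by (rule finite_measureI) (use outer_le_L_1[of UNIV] in \<open>auto simp: emeasure_riesz_measure top_unique\<close>)

lemma emeasure_riesz_measure_UNIV: "emeasure riesz_measure UNIV = ennreal (L 1)"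
proof -
  have "emeasure riesz_measure UNIV = emeasure riesz_measure S + emeasure riesz_measure (- S)"
    using closed_S plus_emeasure[of S riesz_measure "- S"] by simp
  then show ?thesis
    using closed_S by (simp add: emeasure_riesz_measure_Compl_S emeasure_riesz_measure_closed content_S)
qed

text \<open>Outer regularity holds by definition. Applied to the complement of \<open>B\<close> it gives an open \<open>U\<close>, and \<open>S - U\<close> is a compact
subset of \<open>B\<close> of almost full measure.\<close>

lemma riesz_measure_inner_regular:
  assumes B: "B \<in> sets borel"
  shows "emeasure riesz_measure B = (SUP K\<in>{K. compact K \<and> K \<subseteq> B}. emeasure riesz_measure K)"
proof (rule antisym)
  interpret finite_measure riesz_measure by (rule finite_riesz_measure)
  have bm: "K \<in> sets borel" if "compact K" for K :: "('a \<Rightarrow> real) set"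
    using compact_imp_closed_fun[OF that] by simp
  show "(SUP K\<in>{K. compact K \<and> K \<subseteq> B}. emeasure riesz_measure K) \<le> emeasure riesz_measure B"
    using B bm by (intro SUP_least emeasure_mono) auto
  show "emeasure riesz_measure B \<le> (SUP K\<in>{K. compact K \<and> K \<subseteq> B}. emeasure riesz_measure K)"
  proof (rule ennreal_le_epsilon)
    fix e :: real assume e: "0 < e"
    have "outer_content (- B) < outer_content (- B) + ennreal e"
      using e le_less_trans[OF outer_le_L_1[of "- B"] ennreal_less_top] by (auto simp: less_top)
    then have "\<exists>U\<in>{U. open U \<and> - B \<subseteq> U}. inner_content U < outer_content (- B) + ennreal e"
      unfolding outer_content_def[of "- B"] by (simp only: INF_less_iff)
    then obtain U where U: "open U" "- B \<subseteq> U" "inner_content U < outer_content (- B) + ennreal e" by auto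
    have Ub: "U \<in> sets borel" and Bb: "- B \<in> sets borel" using U B by auto
    have "emeasure riesz_measure U = emeasure riesz_measure (- B) + emeasure riesz_measure (B \<inter> U)"
      using U(2) Ub B Bb by (subst plus_emeasure) (auto intro!: arg_cong2[of _ _ _ _ emeasure])
    then have "emeasure riesz_measure (- B) + emeasure riesz_measure (B \<inter> U) < emeasure riesz_measure (- B) + ennreal e"
      using U by (simp only: emeasure_riesz_measure[OF Bb] emeasure_riesz_measure[OF Ub] outer_open)
    then have small: "emeasure riesz_measure (B \<inter> U) \<le> ennreal e"
      by (intro less_imp_le) (simp only: ennreal_add_left_cancel_less)
    have cpt: "compact (S \<inter> - U)" using U(1) by (intro compact_Int_closed compact_S) auto
    have "emeasure riesz_measure B \<le> emeasure riesz_measure ((S \<inter> - U) \<union> ((B \<inter> U) \<union> - S))"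
      using bm[OF cpt] B Ub closed_S by (intro emeasure_mono) auto
    also have "\<dots> \<le> emeasure riesz_measure (S \<inter> - U) + emeasure riesz_measure ((B \<inter> U) \<union> - S)"
      using bm[OF cpt] B Ub closed_S by (intro emeasure_subadditive) auto
    also have "\<dots> \<le> emeasure riesz_measure (S \<inter> - U) + (emeasure riesz_measure (B \<inter> U) + emeasure riesz_measure (- S))"
      using B Ub closed_S by (intro add_left_mono emeasure_subadditive) auto
    also have "\<dots> \<le> (SUP K\<in>{K. compact K \<and> K \<subseteq> B}. emeasure riesz_measure K) + ennreal e"
      using U(2) cpt small
      by (intro add_mono SUP_upper) (auto simp: emeasure_riesz_measure_Compl_S)
    finally show "emeasure riesz_measure B \<le> (SUP K\<in>{K. compact K \<and> K \<subseteq> B}. emeasure riesz_measure K) + ennreal e" .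
  qed
qed

end

section \<open>Integrals against the Riesz measure\<close>

text \<open>The functions \<open>clamp01 (x - k)\<close> for \<open>k < n\<close> are the steps of a continuous staircase: they add up to \<open>x\<close> on
\<open>[0, n]\<close>, and the \<open>k\<close>-th one equals \<open>1\<close> as soon as \<open>x \<ge> k + 1\<close>.\<close>

definition clamp01 :: "real \<Rightarrow> real" where
  "clamp01 x = max 0 (min 1 x)"

lemma sum_clamp01: "0 \<le> x \<Longrightarrow> (\<Sum>k<n. clamp01 (x - real k)) = min x (real n)"
  by (induction n) (auto simp: clamp01_def min_def max_def)

lemma le_sum_of_bool:
  assumes "0 \<le> x" "x \<le> real n"
  shows "x \<le> 1 + (\<Sum>k<n. of_bool (real (Suc k) \<le> x))"
proof -
  have "x = (\<Sum>k<n. clamp01 (x - real k))" using assms by (simp add: sum_clamp01)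
  also have "\<dots> \<le> (\<Sum>k<n. of_bool (real k \<le> x))"
    by (intro sum_mono) (auto simp: clamp01_def)
  also have "\<dots> \<le> (\<Sum>k<Suc n. of_bool (real k \<le> x))" by simp
  also have "\<dots> = of_bool (real 0 \<le> x) + (\<Sum>k<n. of_bool (real (Suc k) \<le> x))"
    by (rule sum.lessThan_Suc_shift)
  finally show ?thesis using assms(1) by simp
qed

context positive_on_characters
begin

lemma bounded_on_S:
  obtains B where "0 < B" "\<And>\<alpha>. \<alpha> \<in> S \<Longrightarrow> \<bar>\<alpha> a\<bar> \<le> B"
proof -
  have "bounded ((\<lambda>\<alpha>. \<alpha> a) ` S)"
    by (intro compact_imp_bounded compact_continuous_image compact_S continuous_on_evaluation)
  then show ?thesis using that by (auto simp: bounded_pos)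
qed

lemma measurable_evaluation: "(\<lambda>\<alpha>. \<alpha> a) \<in> borel_measurable (borel :: ('a \<Rightarrow> real) measure)"
  by (intro borel_measurable_continuous_onI continuous_on_evaluation)

lemma integrable_evaluation: "integrable riesz_measure (\<lambda>\<alpha>. \<alpha> a)"
proof -
  interpret finite_measure riesz_measure by (rule finite_riesz_measure)
  obtain B where B: "0 < B" "\<And>\<alpha>. \<alpha> \<in> S \<Longrightarrow> \<bar>\<alpha> a\<bar> \<le> B" by (rule bounded_on_S) blast
  show ?thesis
    by (rule integrable_const_bound[where B = B]) (use AE_riesz_measure B measurable_evaluation in auto)
qed

text \<open>The function \<open>n * \<alpha> a\<close> is a sum of \<open>n\<close> continuous steps, the \<open>k\<close>-th of which is \<open>1\<close> on the level set where
\<open>n * \<alpha> a \<ge> k + 1\<close>. By density each step is dominated by an element \<open>c k\<close> of the algebra that exceeds it by at most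
\<open>2 / n\<close>, so \<open>L (c k)\<close> bounds the content of the level set. The errors add up to \<open>2 * L 1\<close>.\<close>

lemma sum_content_level_sets_le:
  assumes a: "\<And>\<alpha>. \<alpha> \<in> S \<Longrightarrow> 0 \<le> \<alpha> a \<and> \<alpha> a \<le> 1" and n: "0 < n"
  shows "(\<Sum>k<n. upper_content S L (S \<inter> {\<alpha>. real (Suc k) \<le> real n * \<alpha> a})) \<le> real n * L a + 2 * L 1"
proof -
  define g where "g k \<alpha> = clamp01 (real n * \<alpha> a - real k)" for k and \<alpha> :: "'a \<Rightarrow> real"
  have "\<exists>b. \<forall>\<alpha>\<in>S. \<bar>g k \<alpha> - \<alpha> b\<bar> < 1 / real n" for k
  proof -
    have cont: "continuous_on S (g k)"
      unfolding g_def clamp01_def by (intro continuous_intros continuous_on_evaluation)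
    obtain b where "\<And>\<alpha>. \<alpha> \<in> S \<Longrightarrow> \<bar>g k \<alpha> - \<alpha> b\<bar> < 1 / real n"
      by (rule evaluations_dense[OF compact_S S_characters cont, of "1 / real n"]) (use n in auto)
    then show ?thesis by blast
  qed
  then obtain b where b: "\<And>k \<alpha>. \<alpha> \<in> S \<Longrightarrow> \<bar>g k \<alpha> - \<alpha> (b k)\<bar> < 1 / real n" by metis
  define c where "c k = b k + of_real (1 / real n)" for k
  have c: "g k \<alpha> \<le> \<alpha> (c k) \<and> \<alpha> (c k) \<le> g k \<alpha> + 2 / real n" if "\<alpha> \<in> S" for k \<alpha>
    using b[OF that, of k] unfolding c_def S_simps(1,8)[OF that] by (simp add: abs_less_iff)
  have "upper_content S L (S \<inter> {\<alpha>. real (Suc k) \<le> real n * \<alpha> a}) \<le> L (c k)" for k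
  proof (rule content_le)
    show "0 \<le> \<alpha> (c k)" if "\<alpha> \<in> S" for \<alpha>
      using c[OF that, of k] by (simp add: g_def clamp01_def)
    show "1 \<le> \<alpha> (c k)" if "\<alpha> \<in> S \<inter> {\<alpha>. real (Suc k) \<le> real n * \<alpha> a}" for \<alpha>
      using c[of \<alpha> k] that by (simp add: g_def clamp01_def)
  qed
  then have "(\<Sum>k<n. upper_content S L (S \<inter> {\<alpha>. real (Suc k) \<le> real n * \<alpha> a})) \<le> (\<Sum>k<n. L (c k))"
    by (intro sum_mono)
  also have "\<dots> = L (\<Sum>k<n. c k)" by (simp add: linear_sum[OF linear_L])
  also have "\<dots> \<le> L (real n *\<^sub>R a + of_real 2)"
  proof (rule L_mono)
    fix \<alpha> assume \<alpha>: "\<alpha> \<in> S"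
    have "\<alpha> (\<Sum>k<n. c k) = (\<Sum>k<n. \<alpha> (c k))" by (rule S_sum[OF \<alpha>])
    also have "\<dots> \<le> (\<Sum>k<n. g k \<alpha> + 2 / real n)" using c[OF \<alpha>] by (intro sum_mono) auto
    also have "\<dots> = (\<Sum>k<n. g k \<alpha>) + 2" using n by (simp add: sum.distrib)
    also have "(\<Sum>k<n. g k \<alpha>) = real n * \<alpha> a"
      using a[OF \<alpha>] n unfolding g_def by (subst sum_clamp01) (auto simp: min_def mult_le_cancel_left1)
    finally show "\<alpha> (\<Sum>k<n. c k) \<le> \<alpha> (real n *\<^sub>R a + of_real 2)" unfolding S_simps[OF \<alpha>] .
  qed
  also have "\<dots> = real n * L a + 2 * L 1" using L_of_real[of 2] by (simp add: L_simps)
  finally show ?thesis .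
qed

text \<open>A layer-cake argument: up to an error \<open>1\<close>, the value \<open>n * \<alpha> a\<close> is the number of level sets \<open>n * \<alpha> a \<ge> k + 1\<close> that
contain \<open>\<alpha>\<close>, and the measure of a level set is its content. Dividing by \<open>n\<close> makes the total error
vanish in the limit.\<close>

lemma integral_le_L:
  assumes a: "\<And>\<alpha>. \<alpha> \<in> S \<Longrightarrow> 0 \<le> \<alpha> a \<and> \<alpha> a \<le> 1"
  shows "(\<integral>\<alpha>. \<alpha> a \<partial>riesz_measure) \<le> L a"
proof -
  interpret finite_measure riesz_measure by (rule finite_riesz_measure)
  have total: "measure riesz_measure UNIV = L 1"
    by (simp add: measure_def emeasure_riesz_measure_UNIV L_1_nonneg)
  have bound: "real n * (\<integral>\<alpha>. \<alpha> a \<partial>riesz_measure) \<le> real n * L a + 3 * L 1" if n: "0 < n" for n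
  proof -
    define D where "D k = S \<inter> {\<alpha>. real (Suc k) \<le> real n * \<alpha> a}" for k
    have D: "closed (D k)" "D k \<subseteq> S" for k
    proof -
      have "{\<alpha>. real (Suc k) \<le> real n * \<alpha> a} = {\<alpha>. real (Suc k) / real n \<le> \<alpha> a}"
        using n by (auto simp: field_simps)
      then show "closed (D k)" unfolding D_def
        using closed_evaluation_ge[of "real (Suc k) / real n" a] closed_S by auto
    qed (auto simp: D_def)
    have int: "integrable riesz_measure (indicat_real (D k))" for k
      using D(1)[of k] by (intro integrable_real_indicator) (auto simp: less_top[symmetric])
    have "real n * (\<integral>\<alpha>. \<alpha> a \<partial>riesz_measure) = (\<integral>\<alpha>. real n * \<alpha> a \<partial>riesz_measure)" by simp
    also have "\<dots> \<le> (\<integral>\<alpha>. 1 + (\<Sum>k<n. indicat_real (D k) \<alpha>) \<partial>riesz_measure)"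
    proof (rule integral_mono_AE)
      show "AE \<alpha> in riesz_measure. real n * \<alpha> a \<le> 1 + (\<Sum>k<n. indicat_real (D k) \<alpha>)"
        using AE_riesz_measure
      proof eventually_elim
        case (elim \<alpha>)
        have "real n * \<alpha> a \<le> 1 + (\<Sum>k<n. of_bool (real (Suc k) \<le> real n * \<alpha> a))"
          using a[OF elim] by (intro le_sum_of_bool) (auto simp: mult_left_le)
        also have "(\<Sum>k<n. of_bool (real (Suc k) \<le> real n * \<alpha> a)) = (\<Sum>k<n. indicat_real (D k) \<alpha>)"
          using elim by (intro sum.cong) (auto simp: D_def indicator_def)
        finally show ?case .
      qed
    qed (use int integrable_evaluation in auto)
    also have "\<dots> = L 1 + (\<Sum>k<n. measure riesz_measure (D k))"
      using int D(1) by (simp add: Bochner_Integration.integral_add Bochner_Integration.integral_sum total)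
    also have "(\<Sum>k<n. measure riesz_measure (D k)) = (\<Sum>k<n. upper_content S L (D k))"
      using D by (intro sum.cong refl) (simp add: measure_def emeasure_riesz_measure_closed content_nonneg)
    also have "\<dots> \<le> real n * L a + 2 * L 1"
      unfolding D_def by (rule sum_content_level_sets_le[OF a n])
    finally show ?thesis by simp
  qed
  show ?thesis
  proof (rule le_if_le_small_multiples[where K = "3 * L 1"])
    fix e :: real assume "0 < e"
    then obtain n where n: "0 < n" "1 / real n < e"
      using reals_Archimedean[of e] by (auto simp: inverse_eq_divide intro: that[of "Suc _"])
    have "(\<integral>\<alpha>. \<alpha> a \<partial>riesz_measure) \<le> L a + (1 / real n) * (3 * L 1)"
      using bound[OF n(1)] n(1) by (simp add: field_simps)
    also have "\<dots> \<le> L a + e * (3 * L 1)"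
      using n L_1_nonneg by (intro add_left_mono mult_right_mono) auto
    finally show "(\<integral>\<alpha>. \<alpha> a \<partial>riesz_measure) \<le> L a + e * (3 * L 1)" .
  qed
qed

lemma AE_S_eq: "(\<And>\<alpha>. \<alpha> \<in> S \<Longrightarrow> f \<alpha> = g \<alpha>) \<Longrightarrow> AE \<alpha> in riesz_measure. f \<alpha> = g \<alpha>"
  using AE_riesz_measure by (rule AE_mp) auto

text \<open>One inequality suffices, since it may be applied to \<open>a\<close> and to \<open>-a\<close>. An affine change moves the values of \<open>a\<close> on
\<open>S\<close> into \<open>[0, 1]\<close>; it is harmless because the total mass is \<open>L 1\<close>.\<close>

lemma integral_evaluation: "(\<integral>\<alpha>. \<alpha> a \<partial>riesz_measure) = L a"
proof -
  interpret finite_measure riesz_measure by (rule finite_riesz_measure)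
  have total: "measure riesz_measure UNIV = L 1"
    by (simp add: measure_def emeasure_riesz_measure_UNIV L_1_nonneg)
  have le: "(\<integral>\<alpha>. \<alpha> a \<partial>riesz_measure) \<le> L a" for a
  proof -
    obtain B where B: "0 < B" "\<And>\<alpha>. \<alpha> \<in> S \<Longrightarrow> \<bar>\<alpha> a\<bar> \<le> B" by (rule bounded_on_S) blast
    \<comment> \<open>Maps the interval \<open>[-B, B]\<close> onto \<open>[0, 1]\<close>.\<close>
    define b where "b = (1 / (2 * B)) *\<^sub>R (a + of_real B)"
    have b: "\<alpha> b = (\<alpha> a + B) / (2 * B)" if "\<alpha> \<in> S" for \<alpha> using that by (simp add: b_def S_simps)
    have "(\<integral>\<alpha>. \<alpha> b \<partial>riesz_measure) \<le> L b"
    proof (rule integral_le_L)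
      show "0 \<le> \<alpha> b \<and> \<alpha> b \<le> 1" if "\<alpha> \<in> S" for \<alpha>
        using B(1) B(2)[OF that] by (auto simp: b[OF that] field_simps abs_le_iff)
    qed
    also have "L b = (L a + B * L 1) / (2 * B)" by (simp add: b_def L_simps L_of_real)
    also have "(\<integral>\<alpha>. \<alpha> b \<partial>riesz_measure) = (\<integral>\<alpha>. (\<alpha> a + B) / (2 * B) \<partial>riesz_measure)"
      by (rule integral_cong_AE) (use b measurable_evaluation in \<open>auto intro!: AE_S_eq\<close>)
    also have "\<dots> = ((\<integral>\<alpha>. \<alpha> a \<partial>riesz_measure) + B * L 1) / (2 * B)"
      using integrable_evaluation by (simp add: total)
    finally show ?thesis using B(1) by (simp add: divide_le_cancel)
  qed
  have "(\<integral>\<alpha>. \<alpha> (- a) \<partial>riesz_measure) = (\<integral>\<alpha>. - \<alpha> a \<partial>riesz_measure)"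
    by (rule integral_cong_AE) (use measurable_evaluation in \<open>auto intro!: AE_S_eq simp: S_simps\<close>)
  then show ?thesis using le[of a] le[of "- a"] by (simp add: L_simps)
qed

end

section \<open>Representing measures and their supports\<close>

lemma characters_borel [measurable]: "characters \<in> sets borel"
  using closed_characters by (rule borel_closed)

lemma sets_restrict_borel_characters:
  "B \<in> sets (restrict_space borel characters) \<longleftrightarrow> B \<subseteq> characters \<and> B \<in> sets borel"
  by (simp add: sets_restrict_space_iff characters_borel)

lemma measure_support_eq:
  "measure_support M = space M - \<Union>{V. open V \<and> emeasure M (space M \<inter> V) = 0}"
  unfolding measure_support_def openin_open by (auto simp: zero_less_iff_neq_zero)

lemma measure_support_subset_closed:
  assumes "closed S" "emeasure M (space M - S) = 0"
  shows "measure_support M \<subseteq> S"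
  using assms by (auto simp: measure_support_eq Diff_eq open_Compl)

lemma measure_support_eq_Int_closed:
  obtains F where "closed F" "measure_support M = space M \<inter> F"
proof
  show "closed (- \<Union>{V. open V \<and> emeasure M (space M \<inter> V) = 0})" by (auto intro!: open_Union)
qed (auto simp: measure_support_eq)

text \<open>The complement of the support is a union of null open sets, possibly uncountable. Every compact subset is
covered by finitely many of them, so inner regularity makes the whole complement a null set.\<close>

lemma emeasure_Compl_support:
  assumes M: "radon_measure_on X M"
  shows "emeasure M (space M - measure_support M) = 0"
proof -
  have sets: "sets M = sets (restrict_space borel X)" using M by (simp add: radon_measure_on_def)
  have space: "space M = X" using sets_eq_imp_space_eq[OF sets] by (simp add: space_restrict_space)
  have meas: "X \<inter> V \<in> sets M" if "open V" for V
    using that by (simp add: sets sets_restrict_space)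
  let ?B = "space M - measure_support M" and ?N = "{V. open V \<and> emeasure M (space M \<inter> V) = 0}"
  have B: "?B = X \<inter> \<Union>?N" by (auto simp: measure_support_eq space)
  have "?B \<in> sets M" unfolding B by (intro meas open_Union) auto
  then have "emeasure M ?B = (SUP K\<in>{K. compact K \<and> K \<subseteq> ?B}. emeasure M K)"
    using M by (simp add: radon_measure_on_def)
  also have "\<dots> \<le> 0"
  proof (rule SUP_least)
    fix K assume "K \<in> {K. compact K \<and> K \<subseteq> ?B}"
    then have K: "compact K" "K \<subseteq> X" "K \<subseteq> \<Union>?N" unfolding B by auto
    obtain F where F: "F \<subseteq> ?N" "finite F" "K \<subseteq> \<Union>F"
      using compactE[OF K(1,3)] by blast
    have "emeasure M K \<le> emeasure M (\<Union>V\<in>F. X \<inter> V)"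
      using F K by (intro emeasure_mono sets.finite_UN meas) auto
    also have "\<dots> \<le> (\<Sum>V\<in>F. emeasure M (X \<inter> V))"
      using F by (intro emeasure_subadditive_finite) (auto intro: meas)
    also have "\<dots> = 0" using F by (auto simp: space subset_iff)
    finally show "emeasure M K \<le> 0" .
  qed
  finally show ?thesis by simp
qed

lemma emeasure_less_compact:
  assumes M: "radon_measure_on X M" and B: "B \<in> sets M" "emeasure M B < \<infinity>" and e: "0 < e"
  obtains K where "compact K" "K \<subseteq> B" "emeasure M B < emeasure M K + ennreal e"
proof (rule ccontr)
  note witness = that
  assume "\<not> thesis"
  then have *: "emeasure M K + ennreal e \<le> emeasure M B" if "compact K" "K \<subseteq> B" for K
    using witness[OF that] by (auto simp: not_less[symmetric])
  have "emeasure M B + ennreal e = (SUP K\<in>{K. compact K \<and> K \<subseteq> B}. emeasure M K) + ennreal e"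
    using M B by (simp add: radon_measure_on_def)
  also have "\<dots> = (SUP K\<in>{K. compact K \<and> K \<subseteq> B}. emeasure M K + ennreal e)"
    by (intro ennreal_SUP_add_left[symmetric]) (auto intro!: exI[of _ "{}"])
  also have "\<dots> \<le> emeasure M B" using * by (intro SUP_least) auto
  finally have "emeasure M B + ennreal e \<le> emeasure M B + 0" by simp
  then show False using B(2) e by (simp add: ennreal_add_left_cancel_le)
qed

text \<open>Since \<open>\<alpha> 1 = 1\<close> for every character, integrability of \<open>\<alpha> \<mapsto> \<alpha> 1\<close> means that the total mass is finite, and it
equals \<open>L 1\<close>.\<close>

lemma representing_measureD:
  assumes "representing_measure L \<nu>"
  shows "radon_measure_on characters \<nu>" "integrable \<nu> (\<lambda>\<alpha>. \<alpha> a)" "L a = (\<integral>\<alpha>. \<alpha> a \<partial>\<nu>)"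
    "sets \<nu> = sets (restrict_space borel characters)" "space \<nu> = characters"
    "finite_measure \<nu>" "measure \<nu> characters = L 1"
proof -
  show radon: "radon_measure_on characters \<nu>" and int: "integrable \<nu> (\<lambda>\<alpha>. \<alpha> a)"
    and L: "L a = (\<integral>\<alpha>. \<alpha> a \<partial>\<nu>)" for a
    using assms by (auto simp: representing_measure_def)
  show sets: "sets \<nu> = sets (restrict_space borel characters)"
    using radon by (simp add: radon_measure_on_def)
  show space: "space \<nu> = characters"
    using sets_eq_imp_space_eq[OF sets] by (simp add: space_restrict_space)
  have one: "integrable \<nu> (\<lambda>\<alpha>. 1 :: real) \<longleftrightarrow> integrable \<nu> (\<lambda>\<alpha>. \<alpha> 1)"
    by (rule Bochner_Integration.integrable_cong) (simp_all add: space characters_simps)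
  show fin: "finite_measure \<nu>"
    using one int[of 1] by (intro finite_measureI) (simp add: integrable_iff_bounded less_top[symmetric])
  have "L 1 = (\<integral>\<alpha>. 1 \<partial>\<nu>)"
    unfolding L by (rule Bochner_Integration.integral_cong) (simp_all add: space characters_simps)
  then show "measure \<nu> characters = L 1" by (simp add: space)
qed

lemma representing_measure_AE_support:
  assumes \<nu>: "representing_measure L \<nu>" and S: "closed S" "measure_support \<nu> \<subseteq> S"
  shows "AE \<alpha> in \<nu>. \<alpha> \<in> characters \<inter> S"
proof (rule AE_I)
  note D = representing_measureD[OF \<nu>]
  show "{\<alpha> \<in> space \<nu>. \<alpha> \<notin> characters \<inter> S} \<subseteq> characters - S" by (auto simp: D(5))
  show meas: "characters - S \<in> sets \<nu>"
    using S(1) characters_borel by (auto simp: D(4) sets_restrict_borel_characters)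
  obtain F where F: "closed F" "measure_support \<nu> = space \<nu> \<inter> F" by (rule measure_support_eq_Int_closed)
  have "space \<nu> - measure_support \<nu> = characters - F" by (auto simp: F(2) D(5))
  then have "space \<nu> - measure_support \<nu> \<in> sets \<nu>"
    using F(1) characters_borel by (auto simp: D(4) sets_restrict_borel_characters)
  then have "emeasure \<nu> (characters - S) \<le> emeasure \<nu> (space \<nu> - measure_support \<nu>)"
    using S(2) by (intro emeasure_mono) (auto simp: D(5))
  then show "emeasure \<nu> (characters - S) = 0" by (simp add: emeasure_Compl_support[OF D(1)])
qed

lemma positive_on_support:
  assumes \<nu>: "representing_measure L \<nu>" and lin: "linear L"
    and S: "compact S" "S \<subseteq> characters" "measure_support \<nu> \<subseteq> S"
  shows "positive_on_characters S L"
proof (rule positive_on_characters.intro)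
  show "compact S" "S \<subseteq> characters" "linear L" by fact+
  fix a assume "\<And>\<alpha>. \<alpha> \<in> S \<Longrightarrow> 0 \<le> \<alpha> a"
  then show "0 \<le> L a"
    unfolding representing_measureD(3)[OF \<nu>]
    using representing_measure_AE_support[OF \<nu> compact_imp_closed_fun[OF S(1)] S(3)]
    by (intro integral_nonneg_AE) auto
qed

text \<open>Integrating \<open>1\<^sub>C \<le> a\<close> gives \<open>\<nu> C \<le> L a\<close> for every \<open>a\<close> that is admissible for the content. Conversely, inner regularity
provides a compact \<open>K \<subseteq> S - C\<close> that misses little of \<open>S - C\<close>. An \<open>h\<close> that is close to \<open>1\<close> on \<open>C\<close> and to \<open>0\<close> on \<open>K\<close> is almost
admissible, and its integral is close to \<open>\<nu> C\<close>.\<close>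

lemma representing_measure_closed_eq_content:
  assumes \<nu>: "representing_measure L \<nu>" and lin: "linear L"
    and S: "compact S" "S \<subseteq> characters" "measure_support \<nu> \<subseteq> S"
    and C: "closed C" "C \<subseteq> S"
  shows "measure \<nu> C = upper_content S L C"
proof (rule antisym)
  note D = representing_measureD[OF \<nu>]
  interpret finite_measure \<nu> by (rule D(6))
  interpret positive_on_characters S L by (rule positive_on_support[OF \<nu> lin S])
  have AE: "AE \<alpha> in \<nu>. \<alpha> \<in> S"
    using representing_measure_AE_support[OF \<nu> closed_S S(3)] by (rule AE_mp) auto
  have meas: "B \<in> sets \<nu>" if "B \<in> sets borel" "B \<subseteq> S" for B
    using that S(2) by (auto simp: D(4) sets_restrict_borel_characters)
  have C_meas: "C \<in> sets \<nu>" using C by (intro meas) auto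
  have ind: "integrable \<nu> (indicat_real B)" "(\<integral>\<alpha>. indicat_real B \<alpha> \<partial>\<nu>) = measure \<nu> B" if "B \<in> sets \<nu>" for B
    using that by (auto simp: less_top[symmetric])
  show "measure \<nu> C \<le> upper_content S L C"
  proof (rule field_le_epsilon)
    fix e :: real assume e: "0 < e"
    obtain a where a: "\<And>\<alpha>. \<alpha> \<in> S \<Longrightarrow> 0 \<le> \<alpha> a" "\<And>\<alpha>. \<alpha> \<in> C \<Longrightarrow> 1 \<le> \<alpha> a"
      "L a < upper_content S L C + e"
      by (rule content_approx[OF C(2) e]) blast
    have "measure \<nu> C = (\<integral>\<alpha>. indicat_real C \<alpha> \<partial>\<nu>)" by (rule ind(2)[OF C_meas, symmetric])
    also have "\<dots> \<le> (\<integral>\<alpha>. \<alpha> a \<partial>\<nu>)"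
      using AE by (intro integral_mono_AE ind C_meas D(2)) (auto elim!: eventually_mono simp: indicator_def a)
    finally show "measure \<nu> C \<le> upper_content S L C + e" using a(3) by (simp add: D(3))
  qed
  show "upper_content S L C \<le> measure \<nu> C"
  proof (rule le_if_le_small_multiples)
    fix e :: real assume e: "0 < e" "e < 1"
    have SC: "S - C \<in> sets \<nu>" using C closed_S by (intro meas) auto
    obtain K where K: "compact K" "K \<subseteq> S - C" "emeasure \<nu> (S - C) < emeasure \<nu> K + ennreal e"
      by (rule emeasure_less_compact[OF D(1) SC _ e(1)]) (auto simp: less_top[symmetric])
    have K_closed: "closed K" by (rule compact_imp_closed_fun[OF K(1)])
    have K_meas: "K \<in> sets \<nu>" using K K_closed by (intro meas) auto
    have "ennreal (measure \<nu> (S - C)) < ennreal (measure \<nu> K + e)"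
      using K(3) e by (simp add: emeasure_eq_measure)
    then have "measure \<nu> (S - C) < measure \<nu> K + e"
      by (simp add: ennreal_less_iff)
    moreover have "measure \<nu> (S - C - K) = measure \<nu> (S - C) - measure \<nu> K"
      using SC K_meas K(2) by (rule finite_measure_Diff)
    ultimately have rest: "measure \<nu> (S - C - K) < e" by simp
    have "K \<subseteq> S" "C \<inter> K = {}" using K(2) by auto
    then obtain h where h: "\<And>\<alpha>. \<alpha> \<in> S \<Longrightarrow> 0 \<le> \<alpha> h \<and> \<alpha> h \<le> 1"
      "\<And>\<alpha>. \<alpha> \<in> C \<Longrightarrow> 1 - e < \<alpha> h" "\<And>\<alpha>. \<alpha> \<in> K \<Longrightarrow> \<alpha> h < e"
      by (rule evaluations_separate[OF S(1,2) C K_closed _ _ e]) blast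
    have "(1 - e) * upper_content S L C \<le> L h"
      using h e by (intro content_le_scaled C) (auto intro: less_imp_le)
    also have "\<dots> \<le> (\<integral>\<alpha>. indicat_real C \<alpha> + indicat_real (S - C - K) \<alpha> + e \<partial>\<nu>)"
      unfolding D(3)
    proof (intro integral_mono_AE D(2) Bochner_Integration.integrable_add ind C_meas)
      show "S - C - K \<in> sets \<nu>" using SC K_meas by auto
      show "AE \<alpha> in \<nu>. \<alpha> h \<le> indicat_real C \<alpha> + indicat_real (S - C - K) \<alpha> + e"
        using AE
      proof eventually_elim
        case (elim \<alpha>)
        then show ?case using h(1)[of \<alpha>] h(3)[of \<alpha>] e by (auto simp: indicator_def)
      qed
    qed simp
    also have "\<dots> = measure \<nu> C + measure \<nu> (S - C - K) + e * L 1"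
      using ind C_meas SC K_meas by (simp add: D(5,7) Bochner_Integration.integral_add)
    finally show "upper_content S L C \<le> measure \<nu> C + e * (1 + L 1 + upper_content S L C)"
      using rest by (simp add: algebra_simps)
  qed
qed

lemma representing_measure_unique:
  assumes \<mu>: "representing_measure L \<mu>" "compact (measure_support \<mu>)"
    and \<nu>: "representing_measure L \<nu>" "compact (measure_support \<nu>)"
    and lin: "linear L"
  shows "\<mu> = \<nu>"
proof -
  define S where "S = measure_support \<mu> \<union> measure_support \<nu>"
  have S: "compact S" "S \<subseteq> characters"
    using \<mu> \<nu> representing_measureD(5)[OF \<mu>(1)] representing_measureD(5)[OF \<nu>(1)]
    by (auto simp: S_def measure_support_def)
  have closed_S: "closed S" by (rule compact_imp_closed_fun[OF S(1)])
  have compact_eq: "emeasure \<rho> K = ennreal (upper_content S L (K \<inter> S))"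
    if \<rho>: "representing_measure L \<rho>" "measure_support \<rho> \<subseteq> S" and K: "compact K" "K \<subseteq> characters" for \<rho> K
  proof -
    note D = representing_measureD[OF \<rho>(1)]
    interpret finite_measure \<rho> by (rule D(6))
    have K_closed: "closed K" by (rule compact_imp_closed_fun[OF K(1)])
    have "emeasure \<rho> K = emeasure \<rho> (K \<inter> S)"
    proof (rule emeasure_eq_AE)
      show "AE \<alpha> in \<rho>. \<alpha> \<in> K \<longleftrightarrow> \<alpha> \<in> K \<inter> S"
        using representing_measure_AE_support[OF \<rho>(1) closed_S \<rho>(2)] by (rule AE_mp) auto
    qed (use K K_closed closed_S in \<open>auto simp: D(4) sets_restrict_borel_characters\<close>)
    also have "\<dots> = ennreal (measure \<rho> (K \<inter> S))" by (rule emeasure_eq_measure)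
    also have "measure \<rho> (K \<inter> S) = upper_content S L (K \<inter> S)"
      using K_closed closed_S
      by (intro representing_measure_closed_eq_content[OF \<rho>(1) lin S \<rho>(2)]) auto
    finally show ?thesis .
  qed
  note D\<mu> = representing_measureD[OF \<mu>(1)] and D\<nu> = representing_measureD[OF \<nu>(1)]
  show ?thesis
  proof (rule measure_eqI)
    show "sets \<mu> = sets \<nu>" by (simp add: D\<mu>(4) D\<nu>(4))
    fix B assume B: "B \<in> sets \<mu>"
    then have "B \<subseteq> characters" by (simp add: D\<mu>(4) sets_restrict_borel_characters)
    then have "(SUP K\<in>{K. compact K \<and> K \<subseteq> B}. emeasure \<mu> K) = (SUP K\<in>{K. compact K \<and> K \<subseteq> B}. emeasure \<nu> K)"
      using compact_eq[OF \<mu>(1)] compact_eq[OF \<nu>(1)] by (intro SUP_cong refl) (auto simp: S_def)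
    then show "emeasure \<mu> B = emeasure \<nu> B"
      using D\<mu>(1,4) D\<nu>(1,4) B by (simp add: radon_measure_on_def)
  qed
qed

context positive_on_characters
begin

text \<open>The Riesz measure, which lives on all functions, is restricted to the closed set of characters; nothing is lost
because it is concentrated on \<open>S\<close>.\<close>

lemma representing_measure_exists:
  obtains \<nu> where "representing_measure L \<nu>" "compact (measure_support \<nu>)" "measure_support \<nu> \<subseteq> S"
proof
  let ?X = "characters :: ('a \<Rightarrow> real) set"
  define \<nu> where "\<nu> = restrict_space riesz_measure ?X"
  interpret finite_measure riesz_measure by (rule finite_riesz_measure)
  have X: "?X \<inter> space riesz_measure \<in> sets riesz_measure" using characters_borel by simp
  have sets: "sets \<nu> = sets (restrict_space borel ?X)"
    unfolding \<nu>_def by (rule sets_restrict_space_cong[OF sets_riesz_measure])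
  have space: "space \<nu> = ?X" by (simp add: \<nu>_def space_restrict_space)
  have em: "emeasure \<nu> B = emeasure riesz_measure B" if "B \<subseteq> ?X" for B
    unfolding \<nu>_def by (rule emeasure_restrict_space[OF X that])
  have "radon_measure_on ?X \<nu>"
    unfolding radon_measure_on_def
  proof (intro conjI ballI)
    show "\<exists>U. openin (top_of_set ?X) U \<and> \<alpha> \<in> U \<and> emeasure \<nu> U < \<infinity>" if "\<alpha> \<in> ?X" for \<alpha>
      using that by (intro exI[of _ ?X]) (auto simp: em less_top[symmetric])
    show "emeasure \<nu> B = (SUP K\<in>{K. compact K \<and> K \<subseteq> B}. emeasure \<nu> K)" if "B \<in> sets \<nu>" for B
    proof -
      have B: "B \<subseteq> ?X" "B \<in> sets borel" using that by (auto simp: sets sets_restrict_borel_characters)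
      then show ?thesis
        by (simp add: em riesz_measure_inner_regular[OF B(2)]) (intro SUP_cong refl, use B em in auto)
    qed
  qed (rule sets)
  moreover have "integrable \<nu> (\<lambda>\<alpha>. \<alpha> a) \<and> L a = (\<integral>\<alpha>. \<alpha> a \<partial>\<nu>)" for a
  proof
    have AE: "AE \<alpha> in riesz_measure. indicat_real ?X \<alpha> *\<^sub>R \<alpha> a = \<alpha> a"
      using S_characters by (intro AE_S_eq) auto
    have meas: "(\<lambda>\<alpha>. indicat_real ?X \<alpha> *\<^sub>R \<alpha> a) \<in> borel_measurable riesz_measure"
      "(\<lambda>\<alpha>. \<alpha> a) \<in> borel_measurable riesz_measure"
      using measurable_evaluation[of a] characters_borel by (auto intro!: borel_measurable_scaleR)
    show "integrable \<nu> (\<lambda>\<alpha>. \<alpha> a)"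
      unfolding \<nu>_def integrable_restrict_space[OF X] integrable_cong_AE[OF meas AE]
      by (rule integrable_evaluation)
    show "L a = (\<integral>\<alpha>. \<alpha> a \<partial>\<nu>)"
      unfolding \<nu>_def integral_restrict_space[OF X] integral_cong_AE[OF meas AE]
      by (rule integral_evaluation[symmetric])
  qed
  ultimately show "representing_measure L \<nu>" by (simp add: representing_measure_def)
  have "emeasure \<nu> (space \<nu> - S) \<le> emeasure riesz_measure (- S)"
    unfolding space by (subst em) (use closed_S in \<open>auto intro!: emeasure_mono\<close>)
  then show sub: "measure_support \<nu> \<subseteq> S"
    using closed_S by (intro measure_support_subset_closed) (auto simp: emeasure_riesz_measure_Compl_S)
  obtain F where F: "closed F" "measure_support \<nu> = space \<nu> \<inter> F" by (rule measure_support_eq_Int_closed)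
  have "measure_support \<nu> = S \<inter> F" using sub S_characters F(2) by (auto simp: space)
  then show "compact (measure_support \<nu>)" using compact_Int_closed[OF compact_S F(1)] by simp
qed

end

text \<open>If \<open>\<bar>\<alpha> a\<bar> \<le> R\<close> on the support, then \<open>L (a ^ (2 * n)) \<le> R ^ (2 * n) * L 1\<close>. The factor \<open>L 1\<close> is absorbed by
\<open>m ^ (2 * n)\<close> with \<open>m = max 1 (L 1)\<close>, so that the roots are bounded uniformly in \<open>n\<close>.\<close>

lemma representing_measure_C_of_finite:
  assumes \<nu>: "representing_measure L \<nu>" "compact (measure_support \<nu>)"
  shows "C_of L a < \<infinity>"
proof -
  note D = representing_measureD[OF \<nu>(1)]
  interpret finite_measure \<nu> by (rule D(6))
  let ?S = "measure_support \<nu>"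
  have AE: "AE \<alpha> in \<nu>. \<alpha> \<in> characters \<inter> ?S"
    by (rule representing_measure_AE_support[OF \<nu>(1) compact_imp_closed_fun[OF \<nu>(2)] order_refl])
  have "bounded ((\<lambda>\<alpha>. \<alpha> a) ` ?S)"
    by (intro compact_imp_bounded compact_continuous_image \<nu>(2) continuous_on_evaluation)
  then obtain R where R: "0 < R" "\<And>\<alpha>. \<alpha> \<in> ?S \<Longrightarrow> \<bar>\<alpha> a\<bar> \<le> R" by (auto simp: bounded_pos)
  define m where "m = max 1 (L 1)"
  have "root (2 * n) (L (a ^ (2 * n))) \<le> R * m" if n: "n \<ge> 1" for n
  proof -
    have "L (a ^ (2 * n)) \<le> (\<integral>\<alpha>. R ^ (2 * n) \<partial>\<nu>)"
      unfolding D(3)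
    proof (intro integral_mono_AE D(2))
      show "AE \<alpha> in \<nu>. \<alpha> (a ^ (2 * n)) \<le> R ^ (2 * n)"
        using AE
      proof eventually_elim
        case (elim \<alpha>)
        then have "\<alpha> (a ^ (2 * n)) = \<bar>\<alpha> a\<bar> ^ (2 * n)" by (simp add: characters_simps power_even_abs)
        also have "\<dots> \<le> R ^ (2 * n)" using R elim by (intro power_mono) auto
        finally show ?case .
      qed
    qed simp
    also have "\<dots> = R ^ (2 * n) * L 1" by (simp add: D(5,7))
    also have "\<dots> \<le> R ^ (2 * n) * m ^ (2 * n)"
    proof (rule mult_left_mono)
      have "L 1 \<le> m" by (simp add: m_def)
      also have "\<dots> \<le> m ^ (2 * n)" using n by (intro self_le_power) (auto simp: m_def)
      finally show "L 1 \<le> m ^ (2 * n)" .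
    qed (use R in simp)
    also have "\<dots> = (R * m) ^ (2 * n)" by (simp add: power_mult_distrib)
    finally have "root (2 * n) (L (a ^ (2 * n))) \<le> root (2 * n) ((R * m) ^ (2 * n))"
      using n by (intro real_root_le_mono) auto
    also have "\<dots> = R * m" using n R by (intro real_root_power_cancel) (auto simp: m_def)
    finally show ?thesis .
  qed
  then have "C_of L a \<le> ereal (R * m)" unfolding C_of_def by (intro SUP_least) auto
  then show ?thesis by (rule le_less_trans) simp
qed

lemma representing_measure_Q_of:
  assumes \<nu>: "representing_measure L \<nu>" "compact (measure_support \<nu>)"
    and Q: "measure_support \<nu> \<subseteq> nonneg_characters Q"
  shows "Q \<subseteq> Q_of L"
proof
  fix q assume q: "q \<in> Q"
  have AE: "AE \<alpha> in \<nu>. \<alpha> \<in> characters \<inter> measure_support \<nu>"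
    by (rule representing_measure_AE_support[OF \<nu>(1) compact_imp_closed_fun[OF \<nu>(2)] order_refl])
  have "0 \<le> L (b\<^sup>2 * q)" for b
    unfolding representing_measureD(3)[OF \<nu>(1)]
  proof (rule integral_nonneg_AE)
    show "AE \<alpha> in \<nu>. 0 \<le> \<alpha> (b\<^sup>2 * q)"
      using AE
    proof eventually_elim
      case (elim \<alpha>)
      then have "0 \<le> \<alpha> q" using Q q by (auto simp: nonneg_characters_def)
      then show ?case using elim by (simp add: characters_simps)
    qed
  qed
  then show "q \<in> Q_of L" by (simp add: Q_of_def)
qed

theorem theorem2p3:
  fixes L :: "'a::{comm_ring_1,real_algebra_1} \<Rightarrow> real" and Q :: "'a set"
  assumes "(characters :: ('a \<Rightarrow> real) set) \<noteq> {}"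
    and "linear L"
    and "positive_semidefinite L"
  shows
    "((\<exists>!\<nu>. representing_measure L \<nu> \<and> compact (measure_support \<nu>) \<and>
            measure_support \<nu> \<subseteq> nonneg_characters Q)
       \<longleftrightarrow> ((\<forall>a. C_of L a < \<infinity>) \<and> Q \<subseteq> Q_of L)) \<and>
     ((\<forall>a. C_of L a < \<infinity>) \<and> Q \<subseteq> Q_of L \<longrightarrow>
       (\<forall>\<nu>. representing_measure L \<nu> \<and> compact (measure_support \<nu>) \<and>
             measure_support \<nu> \<subseteq> nonneg_characters Q \<longrightarrow>
          measure_support \<nu> \<subseteq>
            {\<alpha> \<in> characters. (\<forall>a. ereal \<bar>\<alpha> a\<bar> \<le> C_of L a) \<and> (\<forall>q\<in>Q. 0 \<le> \<alpha> q)}))"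
proof -
  let ?P = "\<lambda>\<nu>. representing_measure L \<nu> \<and> compact (measure_support \<nu>) \<and>
    measure_support \<nu> \<subseteq> nonneg_characters Q"
  let ?K = "{\<alpha> \<in> characters. (\<forall>a. ereal \<bar>\<alpha> a\<bar> \<le> C_of L a) \<and> (\<forall>q\<in>Q. 0 \<le> \<alpha> q)}"
  have unique: "\<mu> = \<nu>" if "?P \<mu>" "?P \<nu>" for \<mu> \<nu>
    using that by (intro representing_measure_unique[OF _ _ _ _ assms(2)]) auto
  have necessary: "(\<forall>a. C_of L a < \<infinity>) \<and> Q \<subseteq> Q_of L" if "?P \<nu>" for \<nu>
    using that representing_measure_C_of_finite representing_measure_Q_of by blast
  have sufficient: "\<exists>\<nu>. ?P \<nu> \<and> measure_support \<nu> \<subseteq> ?K"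
    if C: "\<forall>a. C_of L a < \<infinity>" and Q: "Q \<subseteq> Q_of L"
  proof -
    have "positive_on_characters (Q_characters L) L"
    proof (rule positive_on_characters.intro)
      show "compact (Q_characters L)" by (rule compact_Q_characters[OF assms(2,3) C[rule_format]])
      show "Q_characters L \<subseteq> characters" by (auto simp: Q_characters_def)
      show "0 \<le> L a" if "\<And>\<alpha>. \<alpha> \<in> Q_characters L \<Longrightarrow> 0 \<le> \<alpha> a" for a
        by (rule psd_nonneg_on_Q_characters[OF assms(2,3) C[rule_format] that])
    qed (rule assms(2))
    then obtain \<nu> where \<nu>: "representing_measure L \<nu>" "compact (measure_support \<nu>)"
      "measure_support \<nu> \<subseteq> Q_characters L"
      by (rule positive_on_characters.representing_measure_exists)
    have "Q_characters L \<subseteq> ?K"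
    proof
      fix \<alpha> assume \<alpha>: "\<alpha> \<in> Q_characters L"
      have "ereal \<bar>\<alpha> a\<bar> \<le> C_of L a" for a
        by (rule Q_characters_bound[OF assms(2,3) C[rule_format] \<alpha>])
      then show "\<alpha> \<in> ?K" using \<alpha> Q by (auto simp: Q_characters_def)
    qed
    then have "measure_support \<nu> \<subseteq> ?K" using \<nu>(3) by (rule order_trans[rotated])
    moreover have "?K \<subseteq> nonneg_characters Q" by (auto simp: nonneg_characters_def)
    ultimately show ?thesis using \<nu>(1,2) by (intro exI[of _ \<nu>]) simp
  qed
  show ?thesis
  proof (intro conjI iffI impI allI)
    show "\<exists>!\<nu>. ?P \<nu>" if "(\<forall>a. C_of L a < \<infinity>) \<and> Q \<subseteq> Q_of L"
      using sufficient that unique by (intro ex_ex1I) auto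
    show "measure_support \<nu> \<subseteq> ?K"
      if finite: "(\<forall>a. C_of L a < \<infinity>) \<and> Q \<subseteq> Q_of L" and \<nu>: "?P \<nu>" for \<nu>
    proof -
      obtain \<mu> where \<mu>: "?P \<mu>" "measure_support \<mu> \<subseteq> ?K" using sufficient finite by auto
      then show ?thesis using unique[OF \<mu>(1) \<nu>] by simp
    qed
  qed (use necessary in blast)+
qed

end
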